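(* For every positive integer $n$ and every even positive integer $m=2k$, $$N(SO(2n+1),m)=\binom{n+m/2}{m/2}.$$
   Context: $SO(N)$ is the group of real $N\times N$ orthogonal matrices of determinant $1$. $N(G,m)$ denotes the number of conjugacy classes of $G$ (under conjugation by elements of $G$) contained in $\{x\in G: x^m=1\}$. *)

theory Defs
  imports "HOL-Algebra.Group_Action" "Jordan_Normal_Form.Determinant"
begin

definition SO :: "nat \<Rightarrow> real mat monoid" where
  "SO N = \<lparr>carrier = {A \<in> carrier_mat N N. transpose_mat A * A = 1\<^sub>m N \<and> det A = 1},
           monoid.mult = (*), one = 1\<^sub>m N\<rparr>"

definition conj_classes :: "('a, 'b) monoid_scheme \<Rightarrow> 'a set set" where
  "conj_classes G = orbits G (carrier G)
     (\<lambda>g. \<lambda>x \<in> carrier G. g \<otimes>\<^bsub>G\<^esub> x \<otimes>\<^bsub>G\<^esub> inv\<^bsub>G\<^esub> g)"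

text \<open>A class is counted only if all of it lies in the solution set. The cardinality of an infinite
  set is \<open>0\<close>, so a positive value also says that there are finitely many such classes.\<close>

definition num_conj_classes :: "('a, 'b) monoid_scheme \<Rightarrow> nat \<Rightarrow> nat" where
  "num_conj_classes G m =
     card {C \<in> conj_classes G. C \<subseteq> {x \<in> carrier G. x [^]\<^bsub>G\<^esub> m = \<one>\<^bsub>G\<^esub>}}"

lemma SO_simps:
  "A \<in> carrier (SO N) \<longleftrightarrow>
     A \<in> carrier_mat N N \<and> transpose_mat A * A = 1\<^sub>m N \<and> det A = 1"
  "A \<otimes>\<^bsub>SO N\<^esub> B = A * B"
  "\<one>\<^bsub>SO N\<^esub> = 1\<^sub>m N"
  by (auto simp: SO_def)

lemma group_SO: "group (SO N)"
proof (rule groupI, unfold SO_simps)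
  fix A B :: "real mat" assume A: "A \<in> carrier_mat N N \<and> transpose_mat A * A = 1\<^sub>m N \<and> det A = 1"
    and B: "B \<in> carrier_mat N N \<and> transpose_mat B * B = 1\<^sub>m N \<and> det B = 1"
  from A B have c: "A \<in> carrier_mat N N" "B \<in> carrier_mat N N" "A * B \<in> carrier_mat N N"
    "transpose_mat A \<in> carrier_mat N N" "transpose_mat B \<in> carrier_mat N N" by auto
  have "transpose_mat (A * B) * (A * B) = transpose_mat B * (transpose_mat A * (A * B))"
    by (simp add: transpose_mult[OF c(1,2)] assoc_mult_mat[OF c(5,4,3)])
  also have "transpose_mat A * (A * B) = B"
    using A c(2) by (simp flip: assoc_mult_mat[OF c(4,1,2)])
  finally show "A * B \<in> carrier_mat N N \<and> transpose_mat (A * B) * (A * B) = 1\<^sub>m N \<and> det (A * B) = 1"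
    using A B c(3) det_mult[OF c(1,2)] by simp
next
  fix A :: "real mat" assume A: "A \<in> carrier_mat N N \<and> transpose_mat A * A = 1\<^sub>m N \<and> det A = 1"
  then have "A * transpose_mat A = 1\<^sub>m N"
    using mat_mult_left_right_inverse[of "transpose_mat A" N A] by simp
  with A show "\<exists>B\<in>carrier (SO N). B * A = 1\<^sub>m N"
    by (intro bexI[of _ "transpose_mat A"]) (auto simp: SO_simps det_transpose)
qed (auto simp: assoc_mult_mat[of _ N N _ N _ N])

lemma conj_classes_eq:
  "conj_classes G =
     {{g \<otimes>\<^bsub>G\<^esub> x \<otimes>\<^bsub>G\<^esub> inv\<^bsub>G\<^esub> g | g. g \<in> carrier G} | x. x \<in> carrier G}"
  by (auto simp: conj_classes_def orbits_def orbit_def)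

end

theory Submission
  imports Defs "Jordan_Normal_Form.Spectral_Radius" "HOL-Library.Multiset"
begin

text \<open>Every \<open>A\<close> in \<open>SO(2n + 1)\<close> is orthogonally conjugate to a block sum \<open>1 \<oplus> R(\<theta>\<^sub>1) \<oplus> \<dots> \<oplus> R(\<theta>\<^sub>n)\<close>
  with \<open>\<theta>\<^sub>i \<in> [0, \<pi>]\<close>. A complex eigenvector of \<open>A\<close> yields a real eigenvector \<open>v\<close> of \<open>A + A\<^sup>T\<close>, and
  \<open>v\<close>, \<open>A v\<close> span an invariant plane unless \<open>v\<close> is an eigenvector of \<open>A\<close> itself; eigenvalues \<open>\<plusminus>1\<close> are
  paired off by a determinant argument. The multiset of the angles is a complete invariant: blocks may
  be permuted, and the angles are read off the eigenvalues \<open>2 cos \<theta>\<^sub>i\<close> of \<open>A + A\<^sup>T\<close>. Finally \<open>A\<^sup>m = 1\<close>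
  holds iff \<open>cos (m \<theta>\<^sub>i) = 1\<close> for all \<open>i\<close>, which for \<open>m = 2k\<close> leaves the \<open>k + 1\<close> angles \<open>\<pi> j / k\<close>, so
  the classes correspond to the multisets of size \<open>n\<close> over a set of \<open>k + 1\<close> elements.\<close>

section \<open>Orthogonal matrices and orthogonal similarity\<close>

definition orth :: "nat \<Rightarrow> real mat set" where
  "orth n = {Q \<in> carrier_mat n n. transpose_mat Q * Q = 1\<^sub>m n}"

lemma orth_carrier: "Q \<in> orth n \<Longrightarrow> Q \<in> carrier_mat n n"
  by (simp add: orth_def)

lemma orth_left: "Q \<in> orth n \<Longrightarrow> transpose_mat Q * Q = 1\<^sub>m n"
  by (simp add: orth_def)

lemma orth_right: "Q \<in> orth n \<Longrightarrow> Q * transpose_mat Q = 1\<^sub>m n"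
  using mat_mult_left_right_inverse[of "transpose_mat Q" n Q] by (simp add: orth_def)

lemma orth_transpose: "Q \<in> orth n \<Longrightarrow> transpose_mat Q \<in> orth n"
  using orth_right by (simp add: orth_def)

lemma orth_one: "1\<^sub>m n \<in> orth n"
  by (simp add: orth_def)

lemma orth_mult:
  assumes "P \<in> orth n" "Q \<in> orth n"
  shows "P * Q \<in> orth n"
proof -
  note c = assms[THEN orth_carrier]
  have "transpose_mat (P * Q) * (P * Q) = transpose_mat Q * (transpose_mat P * P * Q)"
    using c by (simp add: transpose_mult[OF c] assoc_mult_mat[of _ n n _ n _ n])
  also have "\<dots> = 1\<^sub>m n"
    using c orth_left[OF assms(1)] orth_left[OF assms(2)] by simp
  finally show ?thesis
    using c by (simp add: orth_def)
qed

lemma orth_det: "Q \<in> orth n \<Longrightarrow> det Q * det Q = 1"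
  using arg_cong[OF orth_left, of Q n det] det_mult[of "transpose_mat Q" n Q] det_transpose[of Q n]
  by (simp add: orth_def)

lemma orth_scalar_prod:
  assumes Q: "Q \<in> orth n" and x: "x \<in> carrier_vec n" and y: "y \<in> carrier_vec n"
  shows "(Q *\<^sub>v x) \<bullet> (Q *\<^sub>v y) = x \<bullet> y"
proof -
  note c = orth_carrier[OF Q]
  have "(Q *\<^sub>v x) \<bullet> (Q *\<^sub>v y) = (transpose_mat Q *\<^sub>v (Q *\<^sub>v x)) \<bullet> y"
    using c x y by (simp add: transpose_vec_mult_scalar[of Q n n])
  also have "transpose_mat Q *\<^sub>v (Q *\<^sub>v x) = x"
    using c x by (simp flip: assoc_mult_mat_vec[of _ n n _ n] add: orth_left[OF Q])
  finally show ?thesis .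
qed

lemma orth_transpose_mult_vec:
  assumes Q: "Q \<in> orth n" and x: "x \<in> carrier_vec n"
  shows "transpose_mat Q *\<^sub>v (Q *\<^sub>v x) = x" "Q *\<^sub>v (transpose_mat Q *\<^sub>v x) = x"
  using orth_carrier[OF Q] x
  by (simp_all flip: assoc_mult_mat_vec[of _ n n _ n] add: orth_left[OF Q] orth_right[OF Q])

text \<open>Conjugacy under O(n) rather than SO(n), so that normal forms can be assembled without
  tracking the determinant of the conjugating matrix. \<open>osim_SO\<close> returns to SO(n) at the
  end.\<close>

definition osim :: "nat \<Rightarrow> real mat \<Rightarrow> real mat \<Rightarrow> bool" where
  "osim n A B \<longleftrightarrow> B \<in> carrier_mat n n \<and> (\<exists>Q\<in>orth n. A = Q * B * transpose_mat Q)"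

lemma osim_refl: "A \<in> carrier_mat n n \<Longrightarrow> osim n A A"
  unfolding osim_def by (auto intro!: bexI[of _ "1\<^sub>m n"] simp: orth_one)

lemma osim_trans [trans]:
  assumes "osim n A B" "osim n B C"
  shows "osim n A C"
proof -
  obtain P Q where P: "P \<in> orth n" "A = P * B * transpose_mat P"
    and Q: "Q \<in> orth n" "B = Q * C * transpose_mat Q" and C: "C \<in> carrier_mat n n"
    using assms by (auto simp: osim_def)
  note c = P(1)[THEN orth_carrier] Q(1)[THEN orth_carrier]
  have "A = (P * Q) * C * transpose_mat (P * Q)"
    unfolding P(2) Q(2) using c C
    by (simp add: transpose_mult[OF c] assoc_mult_mat[of _ n n _ n _ n])
  then show ?thesis
    using orth_mult[OF P(1) Q(1)] C by (auto simp: osim_def)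
qed

lemma osim_sym:
  assumes A: "A \<in> carrier_mat n n" and "osim n A B"
  shows "osim n B A"
proof -
  obtain Q where Q: "Q \<in> orth n" "A = Q * B * transpose_mat Q" and B: "B \<in> carrier_mat n n"
    using assms by (auto simp: osim_def)
  note c = orth_carrier[OF Q(1)] orth_transpose[OF Q(1), THEN orth_carrier]
  have "transpose_mat Q * A * Q = transpose_mat Q * (Q * B * (transpose_mat Q * Q))"
    unfolding Q(2) using c B by (simp add: assoc_mult_mat[of _ n n _ n _ n])
  also have "\<dots> = transpose_mat Q * Q * B"
    using c B assoc_mult_mat[OF c(2,1) B] by (simp add: orth_left[OF Q(1)])
  finally have "B = transpose_mat Q * A * transpose_mat (transpose_mat Q)"
    using B by (simp add: orth_left[OF Q(1)])
  then show ?thesis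
    using orth_transpose[OF Q(1)] A unfolding osim_def by blast
qed

lemma osim_orth:
  assumes "A \<in> orth n" "osim n A B"
  shows "B \<in> orth n"
proof -
  obtain Q where "Q \<in> orth n" "B = Q * A * transpose_mat Q"
    using osim_sym[OF orth_carrier[OF assms(1)] assms(2)] by (auto simp: osim_def)
  then show ?thesis
    using orth_mult orth_transpose assms(1) by metis
qed

lemma osim_det:
  assumes "osim n A B"
  shows "det A = det B"
proof -
  obtain Q where Q: "Q \<in> orth n" "A = Q * B * transpose_mat Q" and B: "B \<in> carrier_mat n n"
    using assms by (auto simp: osim_def)
  note c = orth_carrier[OF Q(1)] orth_transpose[OF Q(1), THEN orth_carrier]
  have "det A = det Q * det B * det Q"
    unfolding Q(2) using det_mult[OF mult_carrier_mat[OF c(1) B] c(2)]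
      det_mult[OF c(1) B] det_transpose[OF c(1)] by simp
  then show ?thesis
    using orth_det[OF Q(1)] by (metis mult.assoc mult.commute mult_1)
qed

section \<open>Block sums\<close>

text \<open>The sizes of the zero blocks are read off the arguments, so associativity holds without
  dimension hypotheses.\<close>

definition dsum :: "real mat \<Rightarrow> real mat \<Rightarrow> real mat" where
  "dsum A B = four_block_mat A (0\<^sub>m (dim_row A) (dim_col B)) (0\<^sub>m (dim_row B) (dim_col A)) B"

lemma dsum_carrier [simp]:
  "A \<in> carrier_mat n n \<Longrightarrow> B \<in> carrier_mat m m \<Longrightarrow> dsum A B \<in> carrier_mat (n + m) (n + m)"
  by (simp add: dsum_def)

lemma dsum_eq:
  "A \<in> carrier_mat n n \<Longrightarrow> B \<in> carrier_mat m m \<Longrightarrow>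
   dsum A B = four_block_mat A (0\<^sub>m n m) (0\<^sub>m m n) B"
  by (auto simp: dsum_def)

lemma dsum_assoc: "dsum A (dsum B C) = dsum (dsum A B) C"
  unfolding dsum_def using assoc_four_block_mat[of A B C] by simp

lemma dsum_mult:
  assumes "A \<in> carrier_mat n n" "A' \<in> carrier_mat n n" "B \<in> carrier_mat m m" "B' \<in> carrier_mat m m"
  shows "dsum A B * dsum A' B' = dsum (A * A') (B * B')"
proof -
  have "A * A' \<in> carrier_mat n n" "B * B' \<in> carrier_mat m m" using assms by auto
  then show ?thesis using assms
    by (simp add: dsum_eq[of _ n _ m] mult_four_block_mat[of _ n n _ m _ m _ _ n _ m])
qed

lemma dsum_transpose:
  assumes "A \<in> carrier_mat n n" "B \<in> carrier_mat m m"
  shows "transpose_mat (dsum A B) = dsum (transpose_mat A) (transpose_mat B)"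
  using assms
  by (simp add: dsum_eq[of _ n _ m] transpose_four_block_mat[of _ n n _ m _ m])

lemma dsum_add:
  assumes "A \<in> carrier_mat n n" "A' \<in> carrier_mat n n" "B \<in> carrier_mat m m" "B' \<in> carrier_mat m m"
  shows "dsum A B + dsum A' B' = dsum (A + A') (B + B')"
  using assms add_four_block_mat[of A n n "0\<^sub>m n m" m "0\<^sub>m m n" m B A' "0\<^sub>m n m" "0\<^sub>m m n" B']
  by (simp add: dsum_eq[of _ n _ m])

lemma dsum_one: "dsum (1\<^sub>m n) (1\<^sub>m m) = 1\<^sub>m (n + m)"
  by (simp add: dsum_eq[of _ n _ m])

lemma dsum_pow:
  assumes "A \<in> carrier_mat n n" "B \<in> carrier_mat m m"
  shows "dsum A B ^\<^sub>m k = dsum (A ^\<^sub>m k) (B ^\<^sub>m k)"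
  using assms pow_four_block_mat[OF assms, of k] by (simp add: dsum_eq[of _ n _ m])

lemma dsum_det:
  assumes "A \<in> carrier_mat n n" "B \<in> carrier_mat m m"
  shows "det (dsum A B) = det A * det B"
  using assms by (simp add: dsum_eq[of _ n _ m] det_four_block_mat_lower_left_zero[of _ n _ m])

lemma four_block_mat_inject:
  assumes "A \<in> carrier_mat n n" "A' \<in> carrier_mat n n" "B \<in> carrier_mat n m" "B' \<in> carrier_mat n m"
    and "C \<in> carrier_mat m n" "C' \<in> carrier_mat m n" "D \<in> carrier_mat m m" "D' \<in> carrier_mat m m"
    and eq: "four_block_mat A B C D = four_block_mat A' B' C' D'"
  shows "A = A' \<and> B = B' \<and> C = C' \<and> D = D'"
proof -
  have ix: "four_block_mat A B C D $$ ij = four_block_mat A' B' C' D' $$ ij" for ij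
    using eq by simp
  show ?thesis
  proof (intro conjI eq_matI)
    fix i j assume "i < dim_row A'" "j < dim_col A'"
    then show "A $$ (i, j) = A' $$ (i, j)"
      using ix[of "(i, j)"] assms(1-8) by simp
  next
    fix i j assume "i < dim_row B'" "j < dim_col B'"
    then show "B $$ (i, j) = B' $$ (i, j)"
      using ix[of "(i, n + j)"] assms(1-8) by simp
  next
    fix i j assume "i < dim_row C'" "j < dim_col C'"
    then show "C $$ (i, j) = C' $$ (i, j)"
      using ix[of "(n + i, j)"] assms(1-8) by simp
  next
    fix i j assume "i < dim_row D'" "j < dim_col D'"
    then show "D $$ (i, j) = D' $$ (i, j)"
      using ix[of "(n + i, n + j)"] assms(1-8) by simp
  qed (use assms(1-8) in auto)
qed

lemma dsum_inject:
  assumes "A \<in> carrier_mat n n" "A' \<in> carrier_mat n n" "B \<in> carrier_mat m m" "B' \<in> carrier_mat m m"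
    and "dsum A B = dsum A' B'"
  shows "A = A' \<and> B = B'"
  using assms four_block_mat_inject[of A n A' "0\<^sub>m n m" m "0\<^sub>m n m" "0\<^sub>m m n" "0\<^sub>m m n" B B']
  by (simp add: dsum_eq[of _ n _ m])

lemma dsum_orth:
  assumes "A \<in> orth n" "B \<in> orth m"
  shows "dsum A B \<in> orth (n + m)"
  using assms
  by (auto simp: orth_def dsum_transpose[of _ n _ m] dsum_mult[of _ n _ _ m] dsum_one)

lemma osim_dsum:
  assumes "osim n A A'" "osim m B B'"
  shows "osim (n + m) (dsum A B) (dsum A' B')"
proof -
  obtain P Q where P: "P \<in> orth n" "A = P * A' * transpose_mat P"
    and Q: "Q \<in> orth m" "B = Q * B' * transpose_mat Q"
    and c: "A' \<in> carrier_mat n n" "B' \<in> carrier_mat m m"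
    using assms by (auto simp: osim_def)
  note c = c P(1)[THEN orth_carrier] Q(1)[THEN orth_carrier]
  have "dsum A B = dsum P Q * dsum A' B' * transpose_mat (dsum P Q)"
    using c by (simp add: P(2) Q(2) dsum_transpose[of _ n _ m] dsum_mult[of _ n _ _ m])
  then show ?thesis
    using dsum_orth[OF P(1) Q(1)] c by (auto simp: osim_def)
qed

lemma osim_dsum_commute:
  assumes A: "A \<in> carrier_mat n n" and B: "B \<in> carrier_mat m m"
  shows "osim (n + m) (dsum A B) (dsum B A)"
proof -
  \<comment> \<open>The permutation matrix that moves the last \<open>n\<close> coordinates in front
    of the first \<open>m\<close>.\<close>
  define Q where "Q = four_block_mat (0\<^sub>m n m) (1\<^sub>m n) (1\<^sub>m m) (0\<^sub>m m n :: real mat)"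
  have Q: "Q \<in> carrier_mat (n + m) (n + m)"
    using four_block_carrier_mat[of "0\<^sub>m n m :: real mat" n m "0\<^sub>m m n" m n]
    by (auto simp: Q_def add.commute)
  have QT: "transpose_mat Q = four_block_mat (0\<^sub>m m n) (1\<^sub>m m) (1\<^sub>m n) (0\<^sub>m n m)"
    by (simp add: Q_def transpose_four_block_mat[of _ n m _ n _ m])
  have "transpose_mat Q * Q = 1\<^sub>m (n + m)"
    unfolding QT unfolding Q_def
    by (subst mult_four_block_mat[of _ m n _ m _ n _ _ m _ n]) (auto simp: add.commute)
  then have "Q \<in> orth (n + m)" using Q by (simp add: orth_def)
  moreover have "Q * dsum B A = four_block_mat (0\<^sub>m n m) A B (0\<^sub>m m n)"
    unfolding Q_def dsum_eq[OF B A] using A B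
    by (subst mult_four_block_mat[of _ n m _ n _ m _ _ m _ n]) auto
  moreover have "four_block_mat (0\<^sub>m n m) A B (0\<^sub>m m n) * transpose_mat Q = dsum A B"
    unfolding QT dsum_eq[OF A B] using A B
    by (subst mult_four_block_mat[of _ n m _ n _ m _ _ n _ m]) auto
  ultimately show ?thesis
    using A B dsum_carrier[OF B A] by (auto simp: osim_def add.commute intro!: bexI[of _ Q])
qed

section \<open>Splitting off invariant subspaces\<close>

lemma mult_mat_unit_vec:
  fixes A :: "'a :: semiring_1 mat"
  assumes "A \<in> carrier_mat m n" "j < n"
  shows "A *\<^sub>v unit_vec n j = col A j"
  using assms by (intro eq_vecI) auto

lemma mat_eq_if_mult_vec_eq:
  fixes A B :: "'a :: semiring_1 mat"
  assumes "A \<in> carrier_mat m n" "B \<in> carrier_mat m n"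
    and eq: "\<And>x. x \<in> carrier_vec n \<Longrightarrow> A *\<^sub>v x = B *\<^sub>v x"
  shows "A = B"
proof (rule eq_matI)
  fix i j assume ij: "i < dim_row B" "j < dim_col B"
  have "(A *\<^sub>v unit_vec n j) $ i = (B *\<^sub>v unit_vec n j) $ i" by (simp add: eq)
  then show "A $$ (i, j) = B $$ (i, j)" using assms(1,2) ij by simp
qed (use assms in auto)

section \<open>Reflections, and orthogonal matrices with prescribed first columns\<close>

lemma real_scalar_prod_self:
  fixes v :: "real vec"
  assumes "v \<in> carrier_vec n"
  shows "v \<bullet> v = 0 \<longleftrightarrow> v = 0\<^sub>v n" "v \<bullet> v \<ge> 0"
  using conjugate_square_eq_0_vec[OF assms] conjugate_square_ge_0_vec[of v] by simp_all

text \<open>The matrix is the reflection in the hyperplane orthogonal to \<open>d = u - e\<close>. If \<open>u = e\<close>, then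
  \<open>2 / (d \<bullet> d) = 0\<close> and it is the identity.\<close>

lemma householder:
  fixes e u :: "real vec"
  assumes e: "e \<in> carrier_vec n" "e \<bullet> e = 1" and u: "u \<in> carrier_vec n" "u \<bullet> u = 1"
  obtains H where "H \<in> orth n" "H *\<^sub>v e = u"
    "\<And>x. x \<in> carrier_vec n \<Longrightarrow> x \<bullet> u = x \<bullet> e \<Longrightarrow> H *\<^sub>v x = x"
proof -
  define d where "d = u - e"
  define c where "c = 2 / (d \<bullet> d)"
  define H where "H = mat n n (\<lambda>(i, j). (if i = j then 1 else 0) - c * d $ i * d $ j)"
  have d: "d \<in> carrier_vec n" and H: "H \<in> carrier_mat n n"
    using e u by (auto simp: d_def H_def)
  have Hx: "H *\<^sub>v x = x - (c * (d \<bullet> x)) \<cdot>\<^sub>v d" if x: "x \<in> carrier_vec n" for x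
  proof (rule eq_vecI)
    fix i assume "i < dim_vec (x - (c * (d \<bullet> x)) \<cdot>\<^sub>v d)"
    then have i: "i < n" using d by auto
    have "(H *\<^sub>v x) $ i = (\<Sum>j<n. ((if i = j then 1 else 0) - c * d $ i * d $ j) * x $ j)"
      using i x by (simp add: H_def scalar_prod_def atLeast0LessThan)
    also have "\<dots> = (\<Sum>j<n. (if i = j then x $ j else 0) - c * d $ i * (d $ j * x $ j))"
      by (intro sum.cong refl) (auto simp: algebra_simps)
    also have "\<dots> = x $ i - c * d $ i * (d \<bullet> x)"
      using i x by (simp add: sum_subtractf scalar_prod_def atLeast0LessThan flip: sum_distrib_left)
    finally show "(H *\<^sub>v x) $ i = (x - (c * (d \<bullet> x)) \<cdot>\<^sub>v d) $ i"
      using i x d by simp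
  qed (use x d H in auto)
  \<comment> \<open>The additional factor \<open>c\<close> keeps the identity valid for
    \<open>d\<close> zero, where \<open>c\<close> is zero by the convention on division.\<close>
  have cd: "c * (c * (d \<bullet> d)) = 2 * c"
    by (simp add: c_def)
  have HH: "H *\<^sub>v (H *\<^sub>v x) = x" if x: "x \<in> carrier_vec n" for x
  proof -
    define t where "t = d \<bullet> x"
    have "d \<bullet> (x - (c * t) \<cdot>\<^sub>v d) = t - c * t * (d \<bullet> d)"
      using x d by (simp add: scalar_prod_minus_distrib[of _ n] t_def)
    then have "H *\<^sub>v (H *\<^sub>v x) = x - (c * t) \<cdot>\<^sub>v d - (c * (t - c * t * (d \<bullet> d))) \<cdot>\<^sub>v d"
      using Hx x d by (simp add: t_def)
    also have "c * (t - c * t * (d \<bullet> d)) = - (c * t)"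
      using cd by (auto simp: algebra_simps)
    also have "x - (c * t) \<cdot>\<^sub>v d - (- (c * t)) \<cdot>\<^sub>v d = x"
      using x d by (intro eq_vecI) auto
    finally show ?thesis .
  qed
  have "transpose_mat H = H"
    by (intro eq_matI) (auto simp: H_def)
  moreover have "H * H = 1\<^sub>m n"
    by (rule mat_eq_if_mult_vec_eq[of _ n n])
       (use H HH assoc_mult_mat_vec[of H n n H n] in auto)
  ultimately have "H \<in> orth n"
    using H by (simp add: orth_def)
  moreover have "H *\<^sub>v e = u"
  proof (cases "u = e")
    case True
    then have "d = 0\<^sub>v n" using e by (simp add: d_def)
    then show ?thesis using Hx[OF e(1)] e True by (auto intro!: eq_vecI)
  next
    case False
    have "d \<noteq> 0\<^sub>v n"
    proof
      assume d0: "d = 0\<^sub>v n"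
      have "u $ i = e $ i" if "i < n" for i
      proof -
        have "d $ i = 0" using d0 that by simp
        then show ?thesis using that e u by (simp add: d_def)
      qed
      then show False using False e u by (auto intro!: eq_vecI)
    qed
    then have "d \<bullet> d \<noteq> 0" using d real_scalar_prod_self by blast
    \<comment> \<open>Both vectors have length 1, so the left side is 2 - 2
      (\<open>u \<bullet> e\<close>), while \<open>d \<bullet> e\<close> is
      (\<open>u \<bullet> e\<close>) - 1.\<close>
    moreover have "d \<bullet> d = - (2 * (d \<bullet> e))"
      using e u comm_scalar_prod[of e n u]
      by (simp add: d_def scalar_prod_minus_distrib[of _ n] minus_scalar_prod_distrib[of _ n])
    ultimately have "c * (d \<bullet> e) = - 1"
      by (simp add: c_def field_simps)
    then show ?thesis using Hx[OF e(1)] e u d by (auto intro!: eq_vecI simp: d_def)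
  qed
  moreover have "H *\<^sub>v x = x" if x: "x \<in> carrier_vec n" "x \<bullet> u = x \<bullet> e" for x
  proof -
    have "d \<bullet> x = 0"
      using x e u comm_scalar_prod[of x n]
      by (simp add: d_def minus_scalar_prod_distrib[of _ n])
    then show ?thesis using Hx[OF x(1)] x d by (auto intro!: eq_vecI)
  qed
  ultimately show ?thesis using that by blast
qed

lemma orth_first_col:
  assumes u: "u \<in> carrier_vec (Suc n)" "u \<bullet> u = 1"
  obtains Q where "Q \<in> orth (Suc n)" "col Q 0 = u"
proof -
  obtain H where H: "H \<in> orth (Suc n)" "H *\<^sub>v unit_vec (Suc n) 0 = u"
    using householder[of "unit_vec (Suc n) 0" "Suc n" u] u by auto
  then show ?thesis
    using that[of H] mult_mat_unit_vec[OF orth_carrier[OF H(1)], of 0] by auto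
qed

text \<open>Two reflections suffice. \<open>H\<close> takes the first basis vector to
  \<open>u\<close>, and \<open>G\<close> takes the second one to the preimage \<open>w'\<close> of
  \<open>w\<close> under \<open>H\<close>. Since \<open>w'\<close> and the second basis vector are
  both orthogonal to the first one, \<open>G\<close> fixes the first, and the product has the
  required columns.\<close>

lemma orth_first_two_cols:
  assumes u: "u \<in> carrier_vec (2 + n)" "u \<bullet> u = 1"
    and w: "w \<in> carrier_vec (2 + n)" "w \<bullet> w = 1" and uw: "u \<bullet> w = 0"
  obtains Q where "Q \<in> orth (2 + n)" "col Q 0 = u" "col Q 1 = w"
proof -
  let ?e = "unit_vec (2 + n) :: nat \<Rightarrow> real vec"
  obtain H where H: "H \<in> orth (2 + n)" "H *\<^sub>v ?e 0 = u"
    using householder[of "?e 0" "2 + n" u] u by auto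
  define w' where "w' = transpose_mat H *\<^sub>v w"
  have w': "w' \<in> carrier_vec (2 + n)" "w' \<bullet> w' = 1" "H *\<^sub>v w' = w"
    using w orth_scalar_prod[OF orth_transpose[OF H(1)] w(1) w(1)]
      orth_transpose_mult_vec[OF H(1) w(1)] orth_carrier[OF H(1)] by (auto simp: w'_def)
  have "?e 0 \<bullet> w' = 0"
    using orth_scalar_prod[OF H(1), of "?e 0" w'] H(2) w' uw by simp
  moreover have "?e 0 \<bullet> ?e 1 = 0" by simp
  moreover obtain G where G: "G \<in> orth (2 + n)" "G *\<^sub>v ?e 1 = w'"
    and "\<And>x. x \<in> carrier_vec (2 + n) \<Longrightarrow> x \<bullet> w' = x \<bullet> ?e 1 \<Longrightarrow> G *\<^sub>v x = x"
    by (rule householder[of "?e 1" "2 + n" w']) (use w' in auto)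
  ultimately have Ge: "G *\<^sub>v ?e 0 = ?e 0" by simp
  show ?thesis
  proof (rule that[of "H * G"])
    show HG: "H * G \<in> orth (2 + n)" using H(1) G(1) by (rule orth_mult)
    have "(H * G) *\<^sub>v ?e i = H *\<^sub>v (G *\<^sub>v ?e i)" for i
      using orth_carrier[OF H(1)] orth_carrier[OF G(1)] by simp
    then show "col (H * G) 0 = u" "col (H * G) 1 = w"
      using mult_mat_unit_vec[OF orth_carrier[OF HG], of 0]
        mult_mat_unit_vec[OF orth_carrier[OF HG], of 1] G Ge H w' by simp_all
  qed
qed

text \<open>For an orthogonal matrix, block triangular form with an orthogonal corner is already
  block diagonal. The upper right block of the transpose of \<open>M\<close> times \<open>M\<close>
  must vanish. It is the transpose of \<open>R\<close> times \<open>X\<close>, and \<open>R\<close>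
  is invertible, so \<open>X\<close> is zero.\<close>

lemma orth_block:
  assumes M: "M \<in> orth (r + n)" and R: "R \<in> orth r"
    and ent: "\<And>i j. i < r + n \<Longrightarrow> j < r \<Longrightarrow> M $$ (i, j) = (if i < r then R $$ (i, j) else 0)"
  obtains A' where "A' \<in> orth n" "M = dsum R A'"
proof -
  define X where "X = mat r n (\<lambda>(i, j). M $$ (i, r + j))"
  define A' where "A' = mat n n (\<lambda>(i, j). M $$ (r + i, r + j))"
  note Rc = orth_carrier[OF R] and RTc = orth_carrier[OF orth_transpose[OF R]]
  have c: "X \<in> carrier_mat r n" "A' \<in> carrier_mat n n"
    "transpose_mat X \<in> carrier_mat n r" "transpose_mat A' \<in> carrier_mat n n"
    by (auto simp: X_def A'_def)
  have M_eq: "M = four_block_mat R X (0\<^sub>m n r) A'"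
    using orth_carrier[OF M] Rc by (intro eq_matI) (auto simp: X_def A'_def ent)
  have "transpose_mat M * M = four_block_mat (1\<^sub>m r) (transpose_mat R * X)
      (transpose_mat X * R) (transpose_mat X * X + transpose_mat A' * A')"
    unfolding M_eq using c Rc RTc
    by (simp add: transpose_four_block_mat[of _ r r _ n _ n] orth_left[OF R]
        mult_four_block_mat[of _ r r _ n _ n _ _ r _ n])
  also have "transpose_mat M * M = four_block_mat (1\<^sub>m r) (0\<^sub>m r n) (0\<^sub>m n r) (1\<^sub>m n)"
    using orth_left[OF M] by simp
  finally have *: "transpose_mat R * X = 0\<^sub>m r n"
    "transpose_mat X * X + transpose_mat A' * A' = 1\<^sub>m n"
    using four_block_mat_inject[of "1\<^sub>m r" r "1\<^sub>m r" "0\<^sub>m r n" n "transpose_mat R * X" "0\<^sub>m n r"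
        "transpose_mat X * R" "1\<^sub>m n" "transpose_mat X * X + transpose_mat A' * A'"] c Rc RTc
    by auto
  have "X = R * (transpose_mat R * X)"
    using c assoc_mult_mat[OF Rc RTc c(1)] orth_right[OF R] by simp
  then have X: "X = 0\<^sub>m r n" using * Rc by simp
  then have "A' \<in> orth n" using * c by (simp add: orth_def)
  moreover have "M = dsum R A'"
    unfolding M_eq X using Rc c by (simp add: dsum_eq[of _ r _ n])
  ultimately show ?thesis using that by blast
qed

text \<open>The change of basis given by \<open>Q\<close>: the hypothesis \<open>ent\<close> says
  that the span of the first \<open>r\<close> columns of \<open>Q\<close> is invariant under
  \<open>A\<close>, which acts on it by \<open>R\<close>. Then \<open>orth_block\<close> makes the
  orthogonal complement invariant as well.\<close>

lemma osim_block:
  assumes A: "A \<in> orth (r + n)" and R: "R \<in> orth r" and Q: "Q \<in> orth (r + n)"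
    and ent: "\<And>i j. i < r + n \<Longrightarrow> j < r \<Longrightarrow>
      col Q i \<bullet> (A *\<^sub>v col Q j) = (if i < r then R $$ (i, j) else 0)"
  obtains A' where "A' \<in> orth n" "osim (r + n) A (dsum R A')"
proof -
  note Ac = orth_carrier[OF A] and Qc = orth_carrier[OF Q]
    and QTc = orth_carrier[OF orth_transpose[OF Q]]
  define M where "M = transpose_mat Q * A * Q"
  have "M = transpose_mat Q * (A * Q)"
    unfolding M_def by (rule assoc_mult_mat[OF QTc Ac Qc])
  moreover have "col (A * Q) j = A *\<^sub>v col Q j" if "j < r + n" for j
    using that Ac Qc by (intro eq_vecI) auto
  ultimately have ix: "M $$ (i, j) = col Q i \<bullet> (A *\<^sub>v col Q j)" if "i < r + n" "j < r + n" for i j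
    using that Ac Qc by simp
  have M: "M \<in> orth (r + n)"
    unfolding M_def by (intro orth_mult orth_transpose A Q)
  obtain A' where A': "A' \<in> orth n" "M = dsum R A'"
    by (rule orth_block[OF M R]) (use ix ent in auto)
  have "osim (r + n) M A"
    unfolding osim_def using orth_transpose[OF Q] Ac
    by (auto simp: M_def intro!: bexI[of _ "transpose_mat Q"])
  then have "osim (r + n) A M"
    using osim_sym orth_carrier[OF M] by blast
  then show ?thesis using that A' by blast
qed

lemma col_orth_scalar_prod:
  assumes "Q \<in> orth n" "i < n" "j < n"
  shows "col Q i \<bullet> col Q j = (if i = j then 1 else 0)"
  using arg_cong[OF orth_left[OF assms(1)], of "\<lambda>M. M $$ (i, j)"] orth_carrier[OF assms(1)] assms(2,3)
  by simp

section \<open>Real eigenvectors of an orthogonal matrix and of its symmetric part\<close>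

lemma unit_eigenvector:
  fixes A :: "real mat"
  assumes A: "A \<in> carrier_mat n n" and v: "v \<in> carrier_vec n" "v \<noteq> 0\<^sub>v n" "A *\<^sub>v v = c \<cdot>\<^sub>v v"
  obtains u where "u \<in> carrier_vec n" "u \<bullet> u = 1" "A *\<^sub>v u = c \<cdot>\<^sub>v u"
proof -
  define r where "r = 1 / sqrt (v \<bullet> v)"
  have "v \<bullet> v > 0" using real_scalar_prod_self[OF v(1)] v(2) by linarith
  then have "r * (r * (v \<bullet> v)) = 1" by (simp add: r_def field_simps)
  then show ?thesis
    using that[of "r \<cdot>\<^sub>v v"] v A
    by (simp add: mult_mat_vec[of A n n] smult_smult_assoc mult.commute)
qed

lemma smult_mat_mult_vec:
  "v \<in> carrier_vec (dim_col A) \<Longrightarrow> (c \<cdot>\<^sub>m A) *\<^sub>v v = c \<cdot>\<^sub>v (A *\<^sub>v v)"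
  for A :: "'a :: comm_semiring_0 mat"
  by (intro eq_vecI) auto

text \<open>Here \<open>B - c = - c B (B - c)\<^sup>T\<close>, so the hypothesis on the determinant gives
  \<open>det (B - c) = - det (B - c)\<close>.\<close>

lemma orth_real_eigenvector:
  assumes B: "B \<in> orth n" and c: "c * c = 1" and det: "det B * (- c) ^ n = - 1"
  obtains u where "u \<in> carrier_vec n" "u \<bullet> u = 1" "B *\<^sub>v u = c \<cdot>\<^sub>v u"
proof -
  note Bc = orth_carrier[OF B] and BTc = orth_carrier[OF orth_transpose[OF B]]
  define D where "D = B - c \<cdot>\<^sub>m 1\<^sub>m n"
  have Dc: "D \<in> carrier_mat n n" by (simp add: D_def minus_carrier_mat)
  have "B * transpose_mat D = B * (transpose_mat B - c \<cdot>\<^sub>m 1\<^sub>m n)"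
    using Bc by (intro arg_cong[of _ _ "\<lambda>X. B * X"] eq_matI) (auto simp: D_def)
  also have "\<dots> = 1\<^sub>m n - c \<cdot>\<^sub>m B"
    using Bc BTc orth_right[OF B] mult_smult_distrib[OF Bc one_carrier_mat, of c]
    by (simp add: mult_minus_distrib_mat[of _ n n _ n])
  finally have BD: "B * transpose_mat D = 1\<^sub>m n - c \<cdot>\<^sub>m B" .
  have cc: "c * (c * t) = t" for t
    using c by (simp flip: mult.assoc)
  have "D = (- c) \<cdot>\<^sub>m (B * transpose_mat D)"
    unfolding BD unfolding D_def using Bc
    by (intro eq_matI) (auto simp: right_diff_distrib cc)
  then have "det D = (- c) ^ n * (det B * det D)"
    using Bc Dc det_mult[OF Bc, of "transpose_mat D"] det_transpose[OF Dc]
      det_smult[of "- c" "B * transpose_mat D"] by simp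
  also have "\<dots> = - det D" using det by (metis mult.assoc mult.commute mult_minus1)
  finally have "det D = 0" by simp
  then obtain v where v: "v \<in> carrier_vec n" "v \<noteq> 0\<^sub>v n" "D *\<^sub>v v = 0\<^sub>v n"
    using det_0_iff_vec_prod_zero[OF Dc] by blast
  have "D *\<^sub>v v = B *\<^sub>v v - c \<cdot>\<^sub>v v"
    using Bc v(1) by (simp add: D_def minus_mult_distrib_mat_vec[of _ n n] smult_mat_mult_vec)
  then have "B *\<^sub>v v = D *\<^sub>v v + c \<cdot>\<^sub>v v"
    using Bc v(1) by (intro eq_vecI) auto
  also have "\<dots> = c \<cdot>\<^sub>v v" using v by simp
  finally show ?thesis
    using unit_eigenvector[OF Bc v(1,2)] that by blast
qed

text \<open>A complex eigenvector \<open>z\<close> of \<open>A\<close> has an eigenvalue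
  \<open>l\<close> on the unit circle, and the transpose of \<open>A\<close> multiplies
  \<open>z\<close> by the conjugate of \<open>l\<close>. Hence \<open>z\<close> is an eigenvector of
  the sum for the real number 2 Re \<open>l\<close>. The real and imaginary parts of
  \<open>z\<close> satisfy the same real equation, and one of them is nonzero.\<close>

lemma orth_symmetric_part_eigenvector:
  assumes A: "A \<in> orth n" and n: "n > 0"
  obtains c v where "\<bar>c\<bar> \<le> 1" "v \<in> carrier_vec n" "v \<noteq> 0\<^sub>v n"
    "A *\<^sub>v v + transpose_mat A *\<^sub>v v = (2 * c) \<cdot>\<^sub>v v"
proof -
  define C where "C = map_mat complex_of_real A"
  note Ac = orth_carrier[OF A]
  have Cc: "C \<in> carrier_mat n n" using Ac by (simp add: C_def)
  obtain l z where z: "z \<in> carrier_vec n" "z \<noteq> 0\<^sub>v n" "C *\<^sub>v z = l \<cdot>\<^sub>v z"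
    using spectrum_non_empty[OF Cc n] Cc
    by (auto simp: spectrum_def eigenvalue_def eigenvector_def)
  have CC: "transpose_mat C * C = 1\<^sub>m n"
  proof -
    have "transpose_mat C * C = map_mat complex_of_real (transpose_mat A * A)"
      using Ac unfolding C_def
      by (simp add: map_mat_transpose of_real_hom.mat_hom_mult[of _ n n _ n])
    then show ?thesis
      using orth_left[OF A] by (simp add: of_real_hom.mat_hom_one)
  qed
  have zc: "conjugate z \<in> carrier_vec n" using z by simp
  have conj: "C *\<^sub>v conjugate z = cnj l \<cdot>\<^sub>v conjugate z"
  proof (rule eq_vecI)
    fix i assume "i < dim_vec (cnj l \<cdot>\<^sub>v conjugate z)"
    then have i: "i < n" using z by simp
    have "(C *\<^sub>v conjugate z) $ i = cnj ((C *\<^sub>v z) $ i)"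
      using i z(1) Cc Ac by (simp add: scalar_prod_def C_def)
    then show "(C *\<^sub>v conjugate z) $ i = (cnj l \<cdot>\<^sub>v conjugate z) $ i"
      using i z by simp
  qed (use z Cc in auto)
  have TC: "transpose_mat C *\<^sub>v (C *\<^sub>v z) = z"
    using assoc_mult_mat_vec[OF transpose_carrier_mat[THEN iffD2, OF Cc] Cc z(1)] CC z(1) by simp
  \<comment> \<open>The Hermitian square of \<open>z\<close> is unchanged by \<open>C\<close>, yet
    is multiplied by the squared modulus of \<open>l\<close>. As it is nonzero, \<open>l\<close> has
    modulus 1.\<close>
  have "z \<bullet>c z = (transpose_mat C *\<^sub>v (C *\<^sub>v z)) \<bullet> conjugate z" by (simp add: TC)
  also have "\<dots> = (C *\<^sub>v z) \<bullet> (C *\<^sub>v conjugate z)"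
    using Cc z(1) by (intro transpose_vec_mult_scalar[of C n n]) auto
  also have "\<dots> = (l * cnj l) * (z \<bullet>c z)"
    unfolding z(3) conj using z by simp
  finally have ll: "l * cnj l = 1"
    using z conjugate_square_eq_0_vec[OF z(1)] by simp
  then have "(Re l)\<^sup>2 + (Im l)\<^sup>2 = 1"
    by (metis complex_mult_cnj of_real_eq_1_iff)
  then have "(Re l)\<^sup>2 \<le> 1"
    using zero_le_power2[of "Im l"] by linarith
  then have Rel: "\<bar>Re l\<bar> \<le> 1"
    by (simp add: abs_square_le_1)
  have "l \<cdot>\<^sub>v (transpose_mat C *\<^sub>v z) = z"
    using TC z(1,3) Cc mult_mat_vec[of "transpose_mat C" n n z l] by simp
  then have "(cnj l * l) \<cdot>\<^sub>v (transpose_mat C *\<^sub>v z) = cnj l \<cdot>\<^sub>v z"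
    by (simp flip: smult_smult_assoc)
  moreover have "cnj l * l = 1" using ll by (simp add: mult.commute)
  ultimately have Tz: "transpose_mat C *\<^sub>v z = cnj l \<cdot>\<^sub>v z" by simp
  have S: "C *\<^sub>v z + transpose_mat C *\<^sub>v z = complex_of_real (2 * Re l) \<cdot>\<^sub>v z"
    unfolding z(3) Tz complex_add_cnj[symmetric] by (simp add: add_smult_distrib_vec)
  define x where "x = map_vec Re z"
  define y where "y = map_vec Im z"
  have xy: "x \<in> carrier_vec n" "y \<in> carrier_vec n" using z by (auto simp: x_def y_def)
  have Sx: "A *\<^sub>v x + transpose_mat A *\<^sub>v x = (2 * Re l) \<cdot>\<^sub>v x"
  proof (rule eq_vecI)
    fix i assume "i < dim_vec ((2 * Re l) \<cdot>\<^sub>v x)"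
    then have i: "i < n" using xy by simp
    show "(A *\<^sub>v x + transpose_mat A *\<^sub>v x) $ i = ((2 * Re l) \<cdot>\<^sub>v x) $ i"
      using arg_cong[OF S, of "\<lambda>v. Re (v $ i)"] i z Cc Ac
      by (simp add: scalar_prod_def C_def x_def)
  qed (use xy Ac in auto)
  have Sy: "A *\<^sub>v y + transpose_mat A *\<^sub>v y = (2 * Re l) \<cdot>\<^sub>v y"
  proof (rule eq_vecI)
    fix i assume "i < dim_vec ((2 * Re l) \<cdot>\<^sub>v y)"
    then have i: "i < n" using xy by simp
    show "(A *\<^sub>v y + transpose_mat A *\<^sub>v y) $ i = ((2 * Re l) \<cdot>\<^sub>v y) $ i"
      using arg_cong[OF S, of "\<lambda>v. Im (v $ i)"] i z Cc Ac
      by (simp add: scalar_prod_def C_def y_def)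
  qed (use xy Ac in auto)
  have "x \<noteq> 0\<^sub>v n \<or> y \<noteq> 0\<^sub>v n"
  proof (rule ccontr)
    assume "\<not> ?thesis"
    then have *: "x $ i = 0" "y $ i = 0" if "i < n" for i using that by auto
    have "Re (z $ i) = 0 \<and> Im (z $ i) = 0" if "i < n" for i
      using *[OF that] that z(1) by (simp add: x_def y_def)
    then have "z = 0\<^sub>v n" using z(1) by (auto simp: complex_eq_iff intro!: eq_vecI)
    then show False using z(2) by blast
  qed
  then show ?thesis using that Rel xy Sx Sy by blast
qed

section \<open>Plane rotations\<close>

definition rot :: "real \<Rightarrow> real mat" where
  "rot \<theta> = mat 2 2 (\<lambda>(i, j). if i = j then cos \<theta> else if i < j then - sin \<theta> else sin \<theta>)"

lemma rot_carrier [simp]: "rot \<theta> \<in> carrier_mat 2 2"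
  by (simp add: rot_def)

lemma less_two: "i < (2 :: nat) \<longleftrightarrow> i = 0 \<or> i = 1"
  by auto

lemma rot_mult: "rot \<alpha> * rot \<beta> = rot (\<alpha> + \<beta>)"
proof -
  have sum2: "(\<Sum>i = 0..<2. f i) = f 0 + f 1" for f :: "nat \<Rightarrow> real"
    by (simp add: numeral_2_eq_2)
  show ?thesis
    by (rule eq_matI)
       (auto simp: rot_def scalar_prod_def less_two sum2 cos_add sin_add algebra_simps)
qed

lemma rot_0: "rot 0 = 1\<^sub>m 2"
  by (rule eq_matI) (auto simp: rot_def)

lemma rot_orth: "rot \<theta> \<in> orth 2"
proof -
  have "transpose_mat (rot \<theta>) = rot (- \<theta>)"
    by (rule eq_matI) (auto simp: rot_def less_two)
  then show ?thesis
    by (simp add: orth_def rot_mult rot_0)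
qed

text \<open>A rotation is the square of the rotation by half the angle, whose determinant squares to
  1.\<close>

lemma rot_det: "det (rot \<theta>) = 1"
  using rot_mult[of "\<theta> / 2" "\<theta> / 2"] orth_det[OF rot_orth[of "\<theta> / 2"]]
    det_mult[OF rot_carrier rot_carrier, of "\<theta> / 2" "\<theta> / 2"] by simp

lemma rot_pow: "rot \<theta> ^\<^sub>m k = rot (real k * \<theta>)"
proof (induction k)
  case 0
  then show ?case by (simp add: rot_0) (simp add: rot_def)
next
  case (Suc k)
  then show ?case by (simp add: rot_mult algebra_simps)
qed

lemma rot_eq_one_iff: "rot \<theta> = 1\<^sub>m 2 \<longleftrightarrow> cos \<theta> = 1"
proof
  assume "rot \<theta> = 1\<^sub>m 2"
  then have "rot \<theta> $$ (0, 0) = 1\<^sub>m 2 $$ (0, 0)" by simp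
  then show "cos \<theta> = 1" by (simp add: rot_def)
next
  assume "cos \<theta> = 1"
  then have "cos \<theta> = 1 \<and> sin \<theta> = 0" using sin_cos_squared_add[of \<theta>] by simp
  then show "rot \<theta> = 1\<^sub>m 2" by (intro eq_matI) (auto simp: rot_def)
qed

text \<open>The case of a single column in \<open>osim_block\<close>; \<open>c * c = 1\<close> makes
  the 1 by 1 block orthogonal.\<close>

lemma osim_eigenvector:
  assumes A: "A \<in> orth (1 + n)" and c: "c * c = 1"
    and u: "u \<in> carrier_vec (1 + n)" "u \<bullet> u = 1" "A *\<^sub>v u = c \<cdot>\<^sub>v u"
  obtains A' where "A' \<in> orth n" "osim (1 + n) A (dsum (c \<cdot>\<^sub>m 1\<^sub>m 1) A')"
proof -
  obtain Q where Q: "Q \<in> orth (1 + n)" "col Q 0 = u"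
    using orth_first_col[of u n] u by auto
  have "c \<cdot>\<^sub>m 1\<^sub>m 1 \<in> orth 1"
    using c by (auto simp: orth_def scalar_prod_def intro!: eq_matI)
  then show ?thesis
  proof (rule osim_block[OF A _ Q(1)])
    fix i j :: nat assume ij: "i < 1 + n" "j < 1"
    then have "col Q i \<bullet> (A *\<^sub>v col Q j) = c * (col Q i \<bullet> col Q 0)"
      using u Q orth_carrier[OF Q(1)] by simp
    then show "col Q i \<bullet> (A *\<^sub>v col Q j) = (if i < 1 then (c \<cdot>\<^sub>m 1\<^sub>m 1) $$ (i, j) else 0)"
      using col_orth_scalar_prod[OF Q(1) ij(1), of 0] ij by auto
  qed (use that in blast)
qed

text \<open>Pairing the eigenvector equation with \<open>v\<close> gives the same number twice on
  the left, because the transpose can be moved across the scalar product.\<close>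

lemma orth_symmetric_part_scalar_prod:
  assumes A: "A \<in> orth n" and v: "v \<in> carrier_vec n" "v \<bullet> v = 1"
    and S: "A *\<^sub>v v + transpose_mat A *\<^sub>v v = (2 * c) \<cdot>\<^sub>v v"
  shows "v \<bullet> (A *\<^sub>v v) = c"
proof -
  define q where "q = transpose_mat A *\<^sub>v v"
  note Ac = orth_carrier[OF A]
  have pq: "A *\<^sub>v v \<in> carrier_vec n" "q \<in> carrier_vec n" using Ac v by (auto simp: q_def)
  have "q \<bullet> v = v \<bullet> (A *\<^sub>v v)"
    unfolding q_def using Ac v by (intro transpose_vec_mult_scalar) auto
  moreover have "v \<bullet> (A *\<^sub>v v + q) = 2 * c"
    using S v by (simp add: q_def)
  ultimately show ?thesis
    using pq v comm_scalar_prod[of v n q] by (simp add: scalar_prod_add_distrib[of _ n])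
qed

text \<open>The plane spanned by \<open>v\<close> and its image \<open>p\<close> is invariant, and
  in the orthonormal basis \<open>v\<close>, \<open>w\<close> obtained from it \<open>A\<close> acts
  as a rotation with cosine \<open>c\<close>. The strict bound on \<open>c\<close> makes the sine
  \<open>s\<close> positive, which allows the normalisation of \<open>w\<close>.\<close>

lemma osim_rotation:
  assumes A: "A \<in> orth (2 + n)" and c: "\<bar>c\<bar> < 1"
    and v: "v \<in> carrier_vec (2 + n)" "v \<bullet> v = 1"
    and S: "A *\<^sub>v v + transpose_mat A *\<^sub>v v = (2 * c) \<cdot>\<^sub>v v"
  obtains A' where "A' \<in> orth n" "osim (2 + n) A (dsum (rot (arccos c)) A')"
proof -
  note Ac = orth_carrier[OF A]
  define s where "s = sqrt (1 - c\<^sup>2)"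
  have s: "s > 0" "s * s = 1 - c * c" "sin (arccos c) = s" "cos (arccos c) = c"
    using c abs_square_less_1[of c]
    by (auto simp: s_def sin_arccos_abs cos_arccos_abs simp flip: power2_eq_square)
  define p where "p = A *\<^sub>v v"
  define q where "q = transpose_mat A *\<^sub>v v"
  have pq: "p \<in> carrier_vec (2 + n)" "q \<in> carrier_vec (2 + n)" using Ac v by (auto simp: p_def q_def)
  have vp: "v \<bullet> p = c"
    unfolding p_def by (rule orth_symmetric_part_scalar_prod[OF A v S])
  have pp: "p \<bullet> p = 1" unfolding p_def using orth_scalar_prod[OF A v(1) v(1)] v by simp
  \<comment> \<open>Gram-Schmidt: \<open>c\<close> is the component of \<open>p\<close> along
    \<open>v\<close>, and the remainder has length \<open>s\<close>.\<close>
  define w where "w = (1 / s) \<cdot>\<^sub>v (p - c \<cdot>\<^sub>v v)"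
  have w: "w \<in> carrier_vec (2 + n)" using pq v by (simp add: w_def)
  have vw: "v \<bullet> w = 0"
    using pq v vp by (simp add: w_def scalar_prod_minus_distrib[of _ "2 + n"])
  have "(p - c \<cdot>\<^sub>v v) \<bullet> (p - c \<cdot>\<^sub>v v) = 1 - c * c"
    using pq v vp pp comm_scalar_prod[of p "2 + n" v]
    by (simp add: scalar_prod_minus_distrib[of _ "2 + n"] minus_scalar_prod_distrib[of _ "2 + n"])
  then have ww: "w \<bullet> w = 1"
    using pq v s by (simp add: w_def field_simps)
  have Av: "A *\<^sub>v v = c \<cdot>\<^sub>v v + s \<cdot>\<^sub>v w"
    using pq v s(1) unfolding p_def[symmetric] by (intro eq_vecI) (auto simp: w_def)
  \<comment> \<open>Apply \<open>A\<close> to the eigenvector equation \<open>S\<close> and use that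
    \<open>A\<close> maps \<open>q\<close> back to \<open>v\<close>. This shows that the plane is
    invariant.\<close>
  have Ap: "A *\<^sub>v p = (2 * c) \<cdot>\<^sub>v p - v"
  proof -
    have "A *\<^sub>v (p + q) = (2 * c) \<cdot>\<^sub>v p"
      using S Ac v by (simp add: p_def q_def mult_mat_vec[of A "2 + n" "2 + n"])
    moreover have "A *\<^sub>v (p + q) = A *\<^sub>v p + v"
      using Ac pq orth_transpose_mult_vec(2)[OF A v(1)]
      by (simp add: q_def mult_add_distrib_mat_vec[of A "2 + n" "2 + n"])
    ultimately have "A *\<^sub>v p + v = (2 * c) \<cdot>\<^sub>v p" by simp
    then have "(2 * c) \<cdot>\<^sub>v p - v = A *\<^sub>v p + v - v" by simp
    then show ?thesis using Ac pq v by (auto intro!: eq_vecI)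
  qed
  have Aw: "A *\<^sub>v w = (- s) \<cdot>\<^sub>v v + c \<cdot>\<^sub>v w"
  proof -
    have "A *\<^sub>v w = (1 / s) \<cdot>\<^sub>v ((2 * c) \<cdot>\<^sub>v p - v - c \<cdot>\<^sub>v p)"
      using Ac pq v Ap by (simp add: w_def mult_mat_vec[of A "2 + n" "2 + n"]
          mult_minus_distrib_mat_vec[of A "2 + n" "2 + n"] flip: p_def)
    also have "\<dots> = (- s) \<cdot>\<^sub>v v + c \<cdot>\<^sub>v w"
    proof (rule eq_vecI)
      fix i assume "i < dim_vec ((- s) \<cdot>\<^sub>v v + c \<cdot>\<^sub>v w)"
      then have i: "i < 2 + n" using w by simp
      \<comment> \<open>After multiplication by \<open>s\<close> both sides become
        \<open>c * p $ i - v $ i\<close>, because \<open>s * s = 1 - c * c\<close>.\<close>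
      have "(2 * c * p $ i - v $ i - c * p $ i) / s = - s * v $ i + c * ((p $ i - c * v $ i) / s)"
        using s(1) arg_cong[OF s(2), of "\<lambda>t. t * v $ i"] by (simp add: field_simps)
      then show "((1 / s) \<cdot>\<^sub>v ((2 * c) \<cdot>\<^sub>v p - v - c \<cdot>\<^sub>v p)) $ i = ((- s) \<cdot>\<^sub>v v + c \<cdot>\<^sub>v w) $ i"
        using i pq v by (simp add: w_def)
    qed (use pq v w in auto)
    finally show ?thesis .
  qed
  obtain Q where Q: "Q \<in> orth (2 + n)" "col Q 0 = v" "col Q 1 = w"
    using orth_first_two_cols[OF v w ww vw] by blast
  show ?thesis
  proof (rule osim_block[OF A rot_orth[of "arccos c"] Q(1)])
    fix i j :: nat assume ij: "i < 2 + n" "j < 2"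
    have e: "col Q i \<bullet> v = (if i = 0 then 1 else 0)" "col Q i \<bullet> w = (if i = 1 then 1 else 0)"
      using col_orth_scalar_prod[OF Q(1) ij(1), of 0] col_orth_scalar_prod[OF Q(1) ij(1), of 1] Q
      by simp_all
    have "dim_row Q = 2 + n" using orth_carrier[OF Q(1)] by simp
    then have Qi: "col Q i \<in> carrier_vec (2 + n)" using col_dim[of Q i] by simp
    show "col Q i \<bullet> (A *\<^sub>v col Q j) = (if i < 2 then rot (arccos c) $$ (i, j) else 0)"
      using ij(2) unfolding less_two[of j]
    proof
      assume "j = 0"
      then show ?thesis
        using Qi v w e s Q by (auto simp: Av rot_def less_two scalar_prod_add_distrib[of _ "2 + n"])
    next
      assume "j = 1"
      then show ?thesis
        using Qi v w e s Q by (auto simp: Aw rot_def less_two scalar_prod_add_distrib[of _ "2 + n"])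
    qed
  qed (use that in blast)
qed

text \<open>If \<open>c = \<plusminus>1\<close>, then the complement of the first eigenvector has odd dimension, and \<open>A\<close> has
  determinant \<open>c\<close> on it, so it contains a second eigenvector for \<open>c\<close>.\<close>

lemma osim_even_step:
  assumes A: "A \<in> orth (2 + n)" and n: "even n" and det: "det A = 1"
  obtains \<theta> A' where "0 \<le> \<theta>" "\<theta> \<le> pi" "A' \<in> orth n" "det A' = 1"
    "osim (2 + n) A (dsum (rot \<theta>) A')"
proof -
  have det': "det A' = 1" if "A' \<in> orth n" "osim (2 + n) A (dsum (rot \<theta>) A')" for \<theta> A'
    using osim_det[OF that(2)] dsum_det[OF rot_carrier orth_carrier[OF that(1)]] det
    by (simp add: rot_det)
  note Ac = orth_carrier[OF A]
  define S where "S = A + transpose_mat A"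
  have Sv: "S *\<^sub>v v = A *\<^sub>v v + transpose_mat A *\<^sub>v v" if "v \<in> carrier_vec (2 + n)" for v
    unfolding S_def using Ac that by (intro add_mult_distrib_mat_vec[of _ "2 + n" "2 + n"]) auto
  obtain c v0 where c: "\<bar>c\<bar> \<le> 1" and v0: "v0 \<in> carrier_vec (2 + n)" "v0 \<noteq> 0\<^sub>v (2 + n)"
    "S *\<^sub>v v0 = (2 * c) \<cdot>\<^sub>v v0"
    by (rule orth_symmetric_part_eigenvector[OF A]) (use Sv in auto)
  have "S \<in> carrier_mat (2 + n) (2 + n)" using Ac by (simp add: S_def)
  then obtain v where v: "v \<in> carrier_vec (2 + n)" "v \<bullet> v = 1" "S *\<^sub>v v = (2 * c) \<cdot>\<^sub>v v"
    using unit_eigenvector v0 by blast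
  have Av: "A *\<^sub>v v + transpose_mat A *\<^sub>v v = (2 * c) \<cdot>\<^sub>v v" using v Sv by simp
  show ?thesis
  proof (cases "\<bar>c\<bar> < 1")
    case True
    obtain A' where "A' \<in> orth n" "osim (2 + n) A (dsum (rot (arccos c)) A')"
      by (rule osim_rotation[OF A True v(1,2) Av])
    moreover have "0 \<le> arccos c" "arccos c \<le> pi"
      using c by (auto intro!: arccos_lbound arccos_ubound)
    ultimately show ?thesis using that det' by blast
  next
    case False
    then have c: "c = 1 \<or> c = - 1" using c by linarith
    then have cc: "c * c = 1" by auto
    define d where "d = A *\<^sub>v v - c \<cdot>\<^sub>v v"
    have d: "d \<in> carrier_vec (2 + n)" using Ac v by (simp add: d_def)
    have "(A *\<^sub>v v) \<bullet> (A *\<^sub>v v) = 1" using orth_scalar_prod[OF A v(1) v(1)] v by simp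
    \<comment> \<open>Expanding gives 1 - 2 c^2 + c^2, which vanishes as c^2 = 1. So
      \<open>v\<close> is an eigenvector of \<open>A\<close> itself.\<close>
    then have "d \<bullet> d = 0"
      using Ac v cc orth_symmetric_part_scalar_prod[OF A v(1,2) Av]
        comm_scalar_prod[of "A *\<^sub>v v" "2 + n" v]
      by (simp add: d_def scalar_prod_minus_distrib[of _ "2 + n"]
          minus_scalar_prod_distrib[of _ "2 + n"])
    then have d0: "d = 0\<^sub>v (2 + n)" using real_scalar_prod_self[OF d] by simp
    have "A *\<^sub>v v = d + c \<cdot>\<^sub>v v"
      unfolding d_def using Ac v(1) by (intro eq_vecI) auto
    then have Av: "A *\<^sub>v v = c \<cdot>\<^sub>v v" using d0 v(1) by simp
    let ?c = "c \<cdot>\<^sub>m 1\<^sub>m 1 :: real mat"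
    obtain A1 where A1: "A1 \<in> orth (1 + n)" "osim (2 + n) A (dsum ?c A1)"
      using osim_eigenvector[of A "1 + n" c v] A cc v Av by auto
    have "c * det A1 = 1"
      using osim_det[OF A1(2)] dsum_det[of ?c 1 A1 "1 + n"] orth_carrier[OF A1(1)] det by simp
    then have "det A1 = c" using c by auto
    moreover have "(- c) ^ n = 1" using c n by auto
    \<comment> \<open>The product is \<open>c * (- c)\<close>; this is the sign condition of
      \<open>orth_real_eigenvector\<close> in the odd dimension \<open>1 + n\<close>.\<close>
    ultimately have "det A1 * (- c) ^ (1 + n) = - 1" using cc by simp
    then obtain u where u: "u \<in> carrier_vec (1 + n)" "u \<bullet> u = 1" "A1 *\<^sub>v u = c \<cdot>\<^sub>v u"
      using orth_real_eigenvector[OF A1(1) cc] by blast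
    obtain A2 where A2: "A2 \<in> orth n" "osim (1 + n) A1 (dsum ?c A2)"
      using osim_eigenvector[OF A1(1) cc u] by blast
    have "osim (1 + (1 + n)) (dsum ?c A1) (dsum ?c (dsum ?c A2))"
      by (intro osim_dsum osim_refl A2) simp
    then have "osim (2 + n) A (dsum (dsum ?c ?c) A2)"
      using A1(2) osim_trans by (simp add: dsum_assoc)
    \<comment> \<open>The angle is \<open>0\<close> or \<open>pi\<close> according to the sign of
      \<open>c\<close>: two equal eigenvalues together form a degenerate rotation.\<close>
    moreover obtain \<theta> where "0 \<le> \<theta>" "\<theta> \<le> pi" "cos \<theta> = c" "sin \<theta> = 0"
      using c by (metis cos_pi cos_zero order_refl pi_ge_zero sin_pi sin_zero)
    moreover from this have "dsum ?c ?c = rot \<theta>"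
      by (intro eq_matI) (auto simp: dsum_def rot_def less_two)
    ultimately show ?thesis using that det' A2(1) by metis
  qed
qed

section \<open>Normal form\<close>

primrec rots :: "real list \<Rightarrow> real mat" where
  "rots [] = 1\<^sub>m 0"
| "rots (\<theta> # \<theta>s) = dsum (rot \<theta>) (rots \<theta>s)"

lemma rots_orth: "rots \<theta>s \<in> orth (2 * length \<theta>s)"
proof (induction \<theta>s)
  case (Cons \<theta> \<theta>s)
  then show ?case using dsum_orth[OF rot_orth[of \<theta>]] by fastforce
qed (simp add: orth_one)

lemmas rots_carrier [simp] = orth_carrier[OF rots_orth]

lemma rots_det: "det (rots \<theta>s) = 1"
  by (induction \<theta>s) (simp_all add: dsum_det[OF rot_carrier rots_carrier] rot_det)

text \<open>Iterates \<open>osim_even_step\<close>: the remaining block again has even dimension and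
  determinant 1, as the next step requires.\<close>

lemma osim_rots:
  assumes "A \<in> orth (2 * n)" "det A = 1"
  obtains \<theta>s where "length \<theta>s = n" "set \<theta>s \<subseteq> {0..pi}" "osim (2 * n) A (rots \<theta>s)"
proof -
  have "\<exists>\<theta>s. length \<theta>s = n \<and> set \<theta>s \<subseteq> {0..pi} \<and> osim (2 * n) A (rots \<theta>s)"
    using assms
  proof (induction n arbitrary: A)
    case 0
    then have "A = 1\<^sub>m 0" using orth_carrier[of A 0] by (intro eq_matI) auto
    then show ?case by (simp add: osim_refl)
  next
    case (Suc n)
    have "A \<in> orth (2 + 2 * n)" "even (2 * n)" using Suc.prems by simp_all
    then obtain \<theta> A' where *: "0 \<le> \<theta>" "\<theta> \<le> pi" "A' \<in> orth (2 * n)" "det A' = 1"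
      "osim (2 + 2 * n) A (dsum (rot \<theta>) A')"
      using osim_even_step Suc.prems(2) by blast
    then obtain \<theta>s where "length \<theta>s = n" "set \<theta>s \<subseteq> {0..pi}" "osim (2 * n) A' (rots \<theta>s)"
      using Suc.IH by blast
    moreover from this have "osim (2 + 2 * n) A (dsum (rot \<theta>) (rots \<theta>s))"
      using *(5) osim_dsum[OF osim_refl[OF rot_carrier]] osim_trans by blast
    ultimately show ?case
      using * by (intro exI[of _ "\<theta> # \<theta>s"]) auto
  qed
  then show ?thesis using that by blast
qed

text \<open>For lists of length n these matrices form the standard maximal torus of
  SO(2n+1).\<close>

definition torus :: "real list \<Rightarrow> real mat" where
  "torus \<theta>s = dsum (1\<^sub>m 1) (rots \<theta>s)"

lemma torus_orth: "length \<theta>s = n \<Longrightarrow> torus \<theta>s \<in> orth (1 + 2 * n)"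
  unfolding torus_def using dsum_orth[OF orth_one rots_orth] by blast

lemma torus_det: "det (torus \<theta>s) = 1"
  unfolding torus_def by (simp add: dsum_det[OF one_carrier_mat rots_carrier] rots_det)

text \<open>In odd dimension, determinant 1 forces the eigenvalue 1, since (-1)^(2n+1) = -1.
  Splitting off its eigenvector leaves a block of even dimension and determinant 1 for
  \<open>osim_rots\<close>.\<close>

lemma osim_torus:
  assumes A: "A \<in> orth (1 + 2 * n)" and det: "det A = 1"
  obtains \<theta>s where "length \<theta>s = n" "set \<theta>s \<subseteq> {0..pi}" "osim (1 + 2 * n) A (torus \<theta>s)"
proof -
  obtain u where "u \<in> carrier_vec (1 + 2 * n)" "u \<bullet> u = 1" "A *\<^sub>v u = 1 \<cdot>\<^sub>v u"
    using orth_real_eigenvector[OF A, of 1] det by auto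
  then obtain A' where A': "A' \<in> orth (2 * n)" "osim (1 + 2 * n) A (dsum (1 \<cdot>\<^sub>m 1\<^sub>m 1) A')"
    using osim_eigenvector[OF A, of 1] by auto
  have one: "1 \<cdot>\<^sub>m 1\<^sub>m 1 = (1\<^sub>m 1 :: real mat)" by (intro eq_matI) auto
  note A' = A'[unfolded one]
  have "det A' = 1"
    using osim_det[OF A'(2)] dsum_det[OF one_carrier_mat orth_carrier[OF A'(1)]] det by simp
  then obtain \<theta>s where *: "length \<theta>s = n" "set \<theta>s \<subseteq> {0..pi}" "osim (2 * n) A' (rots \<theta>s)"
    using osim_rots A'(1) by blast
  have "osim (1 + 2 * n) A (torus \<theta>s)"
    using A'(2) osim_dsum[OF osim_refl[OF one_carrier_mat] *(3)] osim_trans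
    unfolding torus_def by blast
  then show ?thesis using that * by blast
qed

text \<open>The block of \<open>y\<close> travels to the front by successive exchanges with its left
  neighbour.\<close>

lemma osim_rots_move:
  "osim (2 * length (xs @ y # ys)) (rots (xs @ y # ys)) (rots (y # xs @ ys))"
proof (induction xs)
  case Nil
  then show ?case using osim_refl[OF rots_carrier[of "y # ys"]] by simp
next
  case (Cons x xs)
  let ?n = "2 * length (xs @ ys)"
  have "osim (2 + (2 + ?n)) (rots ((x # xs) @ y # ys)) (dsum (rot x) (dsum (rot y) (rots (xs @ ys))))"
    using osim_dsum[OF osim_refl[OF rot_carrier[of x]] Cons] by simp
  also have "osim (2 + (2 + ?n)) \<dots> (dsum (rot y) (dsum (rot x) (rots (xs @ ys))))"
    unfolding dsum_assoc add.assoc[symmetric]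
    by (intro osim_dsum osim_dsum_commute osim_refl rot_carrier rots_carrier)
  finally show ?case by simp
qed

text \<open>The head \<open>x\<close> occurs somewhere in \<open>ys\<close>. The induction
  hypothesis matches the other blocks, and \<open>osim_rots_move\<close>, read backwards, puts
  \<open>x\<close> into its place.\<close>

lemma mset_eq_imp_osim_rots:
  assumes "mset xs = mset ys"
  shows "osim (2 * length xs) (rots xs) (rots ys)"
  using assms
proof (induction xs arbitrary: ys)
  case Nil
  then show ?case by (simp add: osim_refl)
next
  case (Cons x xs)
  then obtain y1 y2 where ys: "ys = y1 @ x # y2"
    by (metis list.set_intros(1) set_mset_mset split_list)
  have len: "length ys = length (x # xs)" using Cons.prems mset_eq_length by metis
  have "osim (2 * length xs) (rots xs) (rots (y1 @ y2))"
    using Cons.prems by (intro Cons.IH) (simp add: ys)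
  from osim_dsum[OF osim_refl[OF rot_carrier[of x]] this]
  have "osim (2 * length (x # xs)) (rots (x # xs)) (rots (x # y1 @ y2))" by simp
  also have "osim (2 * length (x # xs)) \<dots> (rots ys)"
    using osim_sym[OF _ osim_rots_move[of y1 x y2]] len rots_carrier[of ys] unfolding ys by metis
  finally show ?case .
qed

lemma mset_eq_imp_osim_torus:
  assumes "mset xs = mset ys" "length xs = n"
  shows "osim (1 + 2 * n) (torus xs) (torus ys)"
  unfolding torus_def using osim_dsum[OF osim_refl[OF one_carrier_mat] mset_eq_imp_osim_rots] assms by blast

lemma rots_pow: "rots \<theta>s ^\<^sub>m k = rots (map (\<lambda>\<theta>. real k * \<theta>) \<theta>s)"
proof (induction \<theta>s)
  case Nil
  show ?case by (induction k) auto
qed (simp add: dsum_pow[OF rot_carrier rots_carrier] rot_pow)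

lemma torus_pow: "torus \<theta>s ^\<^sub>m k = torus (map (\<lambda>\<theta>. real k * \<theta>) \<theta>s)"
proof -
  have "1\<^sub>m 1 ^\<^sub>m k = (1\<^sub>m 1 :: real mat)" by (induction k) auto
  then show ?thesis
    by (simp add: torus_def dsum_pow[OF one_carrier_mat rots_carrier] rots_pow)
qed

lemma rots_eq_one_iff: "rots \<theta>s = 1\<^sub>m (2 * length \<theta>s) \<longleftrightarrow> (\<forall>\<theta>\<in>set \<theta>s. cos \<theta> = 1)"
proof (induction \<theta>s)
  case (Cons \<theta> \<theta>s)
  have "rots (\<theta> # \<theta>s) = 1\<^sub>m (2 * length (\<theta> # \<theta>s)) \<longleftrightarrow>
      dsum (rot \<theta>) (rots \<theta>s) = dsum (1\<^sub>m 2) (1\<^sub>m (2 * length \<theta>s))"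
    by (simp add: dsum_one)
  also have "\<dots> \<longleftrightarrow> rot \<theta> = 1\<^sub>m 2 \<and> rots \<theta>s = 1\<^sub>m (2 * length \<theta>s)"
    using dsum_inject[OF rot_carrier one_carrier_mat rots_carrier one_carrier_mat] by metis
  finally show ?case by (simp add: Cons rot_eq_one_iff)
qed simp

lemma torus_eq_one_iff:
  assumes "length \<theta>s = n"
  shows "torus \<theta>s = 1\<^sub>m (1 + 2 * n) \<longleftrightarrow> (\<forall>\<theta>\<in>set \<theta>s. cos \<theta> = 1)"
proof -
  have "torus \<theta>s = 1\<^sub>m (1 + 2 * n) \<longleftrightarrow> dsum (1\<^sub>m 1) (rots \<theta>s) = dsum (1\<^sub>m 1) (1\<^sub>m (2 * length \<theta>s))"
    using assms by (simp add: torus_def dsum_one)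
  also have "\<dots> \<longleftrightarrow> rots \<theta>s = 1\<^sub>m (2 * length \<theta>s)"
    using dsum_inject[OF one_carrier_mat one_carrier_mat rots_carrier one_carrier_mat] by metis
  finally show ?thesis by (simp add: rots_eq_one_iff)
qed

section \<open>Uniqueness of the angles\<close>

text \<open>Its value on a rotation is the scalar matrix with diagonal entry twice the cosine. Thus
  on the normal forms its characteristic polynomial can be read off the diagonal.\<close>

definition sym_part :: "real mat \<Rightarrow> real mat" where
  "sym_part A = A + transpose_mat A"

text \<open>Conjugation by an orthogonal matrix commutes with transposition, so the same matrix
  conjugates the symmetric parts.\<close>

lemma osim_char_poly_sym_part:
  assumes "osim n A B"
  shows "char_poly (sym_part A) = char_poly (sym_part B)"
proof -
  obtain Q where Q: "Q \<in> orth n" "A = Q * B * transpose_mat Q" and B: "B \<in> carrier_mat n n"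
    using assms by (auto simp: osim_def)
  note c = B orth_carrier[OF Q(1)] orth_transpose[OF Q(1), THEN orth_carrier]
  have B': "transpose_mat B \<in> carrier_mat n n" using B by simp
  have "transpose_mat A = Q * transpose_mat B * transpose_mat Q"
    unfolding Q(2) using c B' transpose_mult[OF mult_carrier_mat[OF c(2,1)] c(3)]
      transpose_mult[OF c(2,1)] assoc_mult_mat[OF c(2) B' c(3)] by simp
  then have "sym_part A = Q * sym_part B * transpose_mat Q"
    unfolding sym_part_def using Q(2) c B' mult_add_distrib_mat[OF c(2,1) B']
      add_mult_distrib_mat[OF mult_carrier_mat[OF c(2,1)] mult_carrier_mat[OF c(2) B'] c(3)] by simp
  moreover have "sym_part A \<in> carrier_mat n n" "sym_part B \<in> carrier_mat n n"
    using c by (auto simp: sym_part_def Q(2))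
  ultimately have "similar_mat (sym_part A) (sym_part B)"
    using c orth_left[OF Q(1)] orth_right[OF Q(1)]
    by (intro similar_matI[of _ _ Q "transpose_mat Q" n]) auto
  then show ?thesis by (rule char_poly_similar)
qed

lemma sym_part_dsum:
  assumes "A \<in> carrier_mat n n" "B \<in> carrier_mat m m"
  shows "sym_part (dsum A B) = dsum (sym_part A) (sym_part B)"
  using assms by (simp add: sym_part_def dsum_transpose[of _ n _ m] dsum_add[of _ n _ _ m])

lemma sym_part_carrier: "A \<in> carrier_mat n n \<Longrightarrow> sym_part A \<in> carrier_mat n n"
  by (simp add: sym_part_def)

lemma sym_part_rot: "upper_triangular (sym_part (rot \<theta>))"
  "diag_mat (sym_part (rot \<theta>)) = [2 * cos \<theta>, 2 * cos \<theta>]"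
  by (auto simp: sym_part_def rot_def diag_mat_def upt_rec numeral_2_eq_2)

lemma sym_part_dsum_diag:
  assumes "A \<in> carrier_mat n n" "B \<in> carrier_mat m m"
  shows "diag_mat (sym_part (dsum A B)) = diag_mat (sym_part A) @ diag_mat (sym_part B)"
  unfolding sym_part_dsum[OF assms] dsum_eq[OF assms[THEN sym_part_carrier]]
  by (rule diag_four_block_mat[OF assms[THEN sym_part_carrier]])

lemma sym_part_dsum_triangular:
  assumes "A \<in> carrier_mat n n" "B \<in> carrier_mat m m"
    and "upper_triangular (sym_part A)" "upper_triangular (sym_part B)"
  shows "upper_triangular (sym_part (dsum A B))"
  unfolding sym_part_dsum[OF assms(1,2)] dsum_eq[OF assms(1,2)[THEN sym_part_carrier]]
  by (rule upper_triangular_four_block[OF assms(1,2)[THEN sym_part_carrier] assms(3,4)])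

lemma sym_part_rots: "upper_triangular (sym_part (rots \<theta>s))"
  "diag_mat (sym_part (rots \<theta>s)) = concat (map (\<lambda>\<theta>. [2 * cos \<theta>, 2 * cos \<theta>]) \<theta>s)"
proof (induction \<theta>s)
  case Nil
  show "upper_triangular (sym_part (rots []))"
    "diag_mat (sym_part (rots [])) = concat (map (\<lambda>\<theta>. [2 * cos \<theta>, 2 * cos \<theta>]) [])"
    by (auto simp: sym_part_def diag_mat_def)
next
  case (Cons \<theta> \<theta>s)
  then show "upper_triangular (sym_part (rots (\<theta> # \<theta>s)))"
    "diag_mat (sym_part (rots (\<theta> # \<theta>s))) = concat (map (\<lambda>\<theta>. [2 * cos \<theta>, 2 * cos \<theta>]) (\<theta> # \<theta>s))"
    using sym_part_dsum_triangular[OF rot_carrier rots_carrier] sym_part_rot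
    by (simp_all add: sym_part_dsum_diag[OF rot_carrier rots_carrier])
qed

lemma proots_prod_linear: "proots (\<Prod>a\<leftarrow>as. [:- a, 1:]) = mset as"
  for as :: "'a :: idom list"
proof (induction as)
  case (Cons a as)
  have "(\<Prod>a\<leftarrow>as. [:- a, 1:]) \<noteq> 0" by (auto simp: prod_list_zero_iff)
  then show ?case using Cons by (simp add: proots_mult del: mult_pCons_left)
qed simp

text \<open>The separate root 2 comes from the 1 by 1 identity block; every angle contributes a
  repeated root.\<close>

lemma proots_char_poly_sym_part_torus:
  "proots (char_poly (sym_part (torus \<theta>s))) =
     add_mset 2 (mset (concat (map (\<lambda>\<theta>. [2 * cos \<theta>, 2 * cos \<theta>]) \<theta>s)))"
proof -
  have "upper_triangular (sym_part (1\<^sub>m 1))" "diag_mat (sym_part (1\<^sub>m 1)) = [2]"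
    by (auto simp: sym_part_def diag_mat_def)
  then have *: "upper_triangular (sym_part (torus \<theta>s))"
    "diag_mat (sym_part (torus \<theta>s)) = 2 # concat (map (\<lambda>\<theta>. [2 * cos \<theta>, 2 * cos \<theta>]) \<theta>s)"
    unfolding torus_def
    using sym_part_dsum_triangular[OF one_carrier_mat rots_carrier] sym_part_rots
    by (simp_all add: sym_part_dsum_diag[OF one_carrier_mat rots_carrier])
  have "sym_part (torus \<theta>s) \<in> carrier_mat (1 + 2 * length \<theta>s) (1 + 2 * length \<theta>s)"
    using orth_carrier[OF torus_orth[OF refl]] by (rule sym_part_carrier)
  from char_poly_upper_triangular[OF this *(1)]
  have "char_poly (sym_part (torus \<theta>s)) = (\<Prod>a\<leftarrow>diag_mat (sym_part (torus \<theta>s)). [:- a, 1:])" .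
  then show ?thesis unfolding *(2) by (simp only: proots_prod_linear mset.simps)
qed

text \<open>Similar matrices give the same roots. After the common root 2 is cancelled, the cosines
  agree with multiplicity, and the cosine is injective on the interval from 0 to pi.\<close>

lemma osim_torus_imp_mset_eq:
  assumes "osim n (torus xs) (torus ys)" "set xs \<subseteq> {0..pi}" "set ys \<subseteq> {0..pi}"
  shows "mset xs = mset ys"
proof -
  \<comment> \<open>Evaluating at \<open>2 * c\<close> undoes the scaling, so halving this count
    recovers the multiplicity of the cosine \<open>c\<close>.\<close>
  have double: "count (mset (concat (map (\<lambda>\<theta>. [2 * cos \<theta>, 2 * cos \<theta>]) zs))) (2 * c) =
      2 * count (mset (map cos zs)) c" for zs :: "real list" and c
    by (induction zs) auto
  have eq: "mset (concat (map (\<lambda>\<theta>. [2 * cos \<theta>, 2 * cos \<theta>]) xs)) =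
      mset (concat (map (\<lambda>\<theta>. [2 * cos \<theta>, 2 * cos \<theta>]) ys))"
    using arg_cong[OF osim_char_poly_sym_part[OF assms(1)], of proots]
    by (simp only: proots_char_poly_sym_part_torus add_mset_add_mset_same_iff)
  have "mset (map cos xs) = mset (map cos ys)"
  proof (rule multiset_eqI)
    fix c
    show "count (mset (map cos xs)) c = count (mset (map cos ys)) c"
      using double[of xs c] double[of ys c] unfolding eq by simp
  qed
  then have "mset (map arccos (map cos xs)) = mset (map arccos (map cos ys))"
    by (metis mset_map)
  moreover have "map arccos (map cos zs) = zs" if "set zs \<subseteq> {0..pi}" for zs
    using that by (auto simp: arccos_cos intro!: map_idI)
  ultimately show ?thesis using assms(2,3) by metis
qed

section \<open>Conjugacy classes of the rotation group\<close>

lemma osim_pow: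
  assumes "osim n A B"
  shows "osim n (A ^\<^sub>m k) (B ^\<^sub>m k)"
proof -
  obtain Q where Q: "Q \<in> orth n" "A = Q * B * transpose_mat Q" and B: "B \<in> carrier_mat n n"
    using assms by (auto simp: osim_def)
  note c = orth_carrier[OF Q(1)] orth_carrier[OF orth_transpose[OF Q(1)]]
  have "A ^\<^sub>m k = Q * B ^\<^sub>m k * transpose_mat Q"
  proof (induction k)
    case 0
    then show ?case using c B orth_right[OF Q(1)] by (simp add: Q(2))
  next
    case (Suc k)
    have Bk: "B ^\<^sub>m k \<in> carrier_mat n n" using B by simp
    have "A ^\<^sub>m Suc k = Q * B ^\<^sub>m k * transpose_mat Q * (Q * B * transpose_mat Q)"
      using Suc by (simp add: Q(2))
    also have "\<dots> = Q * B ^\<^sub>m k * (transpose_mat Q * Q * B * transpose_mat Q)"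
      using c B Bk by (simp add: assoc_mult_mat[of _ n n _ n _ n] mult_carrier_mat[of _ n n _ n])
    also have "\<dots> = Q * B ^\<^sub>m Suc k * transpose_mat Q"
      using c B Bk by (simp add: orth_left[OF Q(1)] assoc_mult_mat[of _ n n _ n _ n]
          mult_carrier_mat[of _ n n _ n])
    finally show ?case .
  qed
  then show ?thesis using Q(1) B by (auto simp: osim_def)
qed

lemma osim_one: "osim n A (1\<^sub>m n) \<Longrightarrow> A = 1\<^sub>m n"
  using orth_right orth_carrier by (fastforce simp: osim_def)

lemma osim_pow_one_iff:
  assumes A: "A \<in> carrier_mat n n" and "osim n A B"
  shows "A ^\<^sub>m k = 1\<^sub>m n \<longleftrightarrow> B ^\<^sub>m k = 1\<^sub>m n"
  using osim_pow[OF assms(2), of k] osim_pow[OF osim_sym[OF assms], of k] osim_one by auto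

section \<open>Passing from O(N) to SO(N)\<close>

lemma SO_carrier_iff: "A \<in> carrier (SO N) \<longleftrightarrow> A \<in> orth N \<and> det A = 1"
  by (auto simp: SO_simps orth_def)

lemma SO_inv: "A \<in> carrier (SO N) \<Longrightarrow> inv\<^bsub>SO N\<^esub> A = transpose_mat A"
  by (rule group.inv_equality[OF group_SO])
     (auto simp: SO_carrier_iff SO_simps(2,3) orth_left orth_transpose
      det_transpose[OF orth_carrier])

lemma SO_pow: "A [^]\<^bsub>SO N\<^esub> k = A ^\<^sub>m k" if "A \<in> carrier (SO N)"
proof -
  interpret group "SO N" by (rule group_SO)
  show ?thesis
    using that by (induction k) (auto simp: SO_simps)
qed

text \<open>In odd dimension \<open>- Q\<close> has determinant \<open>- det Q\<close>, so conjugation by orthogonal matrices and by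
  rotations agree.\<close>

lemma osim_SO:
  assumes "odd N" "osim N A B"
  obtains Q where "Q \<in> carrier (SO N)" "A = Q * B * transpose_mat Q"
proof -
  obtain Q where Q: "Q \<in> orth N" "A = Q * B * transpose_mat Q" and B: "B \<in> carrier_mat N N"
    using assms by (auto simp: osim_def)
  have "det Q = 1 \<or> det Q = - 1"
    using orth_det[OF Q(1)] by (simp add: square_eq_1_iff)
  then show ?thesis
  proof
    assume "det Q = 1"
    then show ?thesis using that Q by (simp add: SO_carrier_iff)
  next
    assume d: "det Q = - 1"
    note c = orth_carrier[OF Q(1)] orth_carrier[OF orth_transpose[OF Q(1)]]
    define P where "P = (- 1) \<cdot>\<^sub>m Q"
    have PT: "transpose_mat P = (- 1) \<cdot>\<^sub>m transpose_mat Q"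
      by (intro eq_matI) (auto simp: P_def)
    have sm: "(- 1) \<cdot>\<^sub>m ((- 1) \<cdot>\<^sub>m X) = X" for X :: "real mat"
      by (intro eq_matI) auto
    have "transpose_mat P * P = (- 1) \<cdot>\<^sub>m ((- 1) \<cdot>\<^sub>m (transpose_mat Q * Q))"
      unfolding PT unfolding P_def using c
      by (simp add: mult_smult_distrib[of _ N N _ N] mult_smult_assoc_mat[of _ N N _ N])
    then have "P \<in> orth N"
      using c orth_left[OF Q(1)] by (simp add: sm orth_def P_def)
    moreover have "det P = 1" using c d assms(1) by (simp add: P_def)
    moreover have "P * B * transpose_mat P = (- 1) \<cdot>\<^sub>m ((- 1) \<cdot>\<^sub>m (Q * B * transpose_mat Q))"
      unfolding PT unfolding P_def using c B
      by (simp add: mult_smult_distrib[of _ N N _ N] mult_smult_assoc_mat[of _ N N _ N])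
    ultimately show ?thesis using that[of P] Q(2) by (simp add: sm SO_carrier_iff)
  qed
qed

text \<open>Brings the group-theoretic orbits into the form to which the normal form applies. The
  oddness of \<open>N\<close> enters through \<open>osim_SO\<close>.\<close>

lemma SO_conj_classes:
  assumes "odd N"
  shows "conj_classes (SO N) = (\<lambda>x. {y. osim N y x}) ` carrier (SO N)"
proof -
  have "{g \<otimes>\<^bsub>SO N\<^esub> x \<otimes>\<^bsub>SO N\<^esub> inv\<^bsub>SO N\<^esub> g | g. g \<in> carrier (SO N)} = {y. osim N y x}"
    if x: "x \<in> carrier (SO N)" for x
  proof (intro Set.set_eqI iffI)
    fix y assume "y \<in> {g \<otimes>\<^bsub>SO N\<^esub> x \<otimes>\<^bsub>SO N\<^esub> inv\<^bsub>SO N\<^esub> g | g. g \<in> carrier (SO N)}"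
    then show "y \<in> {y. osim N y x}"
      using x by (auto simp: SO_inv SO_simps(2) osim_def SO_carrier_iff orth_carrier)
  next
    fix y assume "y \<in> {y. osim N y x}"
    then obtain g where "g \<in> carrier (SO N)" "y = g * x * transpose_mat g"
      using osim_SO[OF assms] by blast
    then have "g \<in> carrier (SO N)" "y = g \<otimes>\<^bsub>SO N\<^esub> x \<otimes>\<^bsub>SO N\<^esub> inv\<^bsub>SO N\<^esub> g"
      by (simp_all add: SO_inv SO_simps(2))
    then show "y \<in> {g \<otimes>\<^bsub>SO N\<^esub> x \<otimes>\<^bsub>SO N\<^esub> inv\<^bsub>SO N\<^esub> g | g. g \<in> carrier (SO N)}"
      by blast
  qed
  then show ?thesis by (auto simp: conj_classes_eq image_iff)
qed

lemma osim_class_cong: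
  assumes "A \<in> carrier_mat n n" "osim n A B"
  shows "{y. osim n y A} = {y. osim n y B}"
  using assms osim_trans osim_sym by blast

text \<open>The equation says that \<open>2 * k * \<theta>\<close> is an integer multiple of
  \<open>2 * pi\<close>. Within the interval this leaves \<open>pi * j / k\<close> for j from 0 to
  \<open>k\<close>; both endpoints occur, hence \<open>k + 1\<close> angles.\<close>

lemma card_angles:
  assumes k: "k > 0"
  defines "T \<equiv> {\<theta> \<in> {0..pi}. cos (real (2 * k) * \<theta>) = 1}"
  shows "finite T" "card T = Suc k"
proof -
  define f where "f = (\<lambda>j. pi * real j / real k)"
  have "T = f ` {0..k}"
  proof (intro Set.set_eqI iffI)
    fix \<theta> assume "\<theta> \<in> T"
    then have \<theta>: "0 \<le> \<theta>" "\<theta> \<le> pi" "cos (real (2 * k) * \<theta>) = 1" by (auto simp: T_def)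
    then obtain i :: int where "real (2 * k) * \<theta> = real_of_int i * 2 * pi"
      using cos_one_2pi_int by blast
    then have i: "real k * \<theta> = real_of_int i * pi" by simp
    have "real_of_int i * pi \<ge> 0" using \<theta> i by (metis mult_nonneg_nonneg of_nat_0_le_iff)
    then have i0: "i \<ge> 0" using pi_gt_zero by (simp add: zero_le_mult_iff)
    have "real_of_int i * pi \<le> real k * pi" using \<theta> unfolding i[symmetric] by (intro mult_left_mono) auto
    then have "i \<le> int k" using pi_gt_zero by simp
    moreover have "\<theta> = f (nat i)" using i i0 k by (simp add: f_def field_simps)
    ultimately show "\<theta> \<in> f ` {0..k}" using i0 by auto
  next
    fix \<theta> assume "\<theta> \<in> f ` {0..k}"
    then obtain j where j: "j \<le> k" "\<theta> = f j" by auto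
    have "real (2 * k) * \<theta> = real_of_int (int j) * 2 * pi" using k by (simp add: j f_def)
    then have "cos (real (2 * k) * \<theta>) = 1" using cos_one_2pi_int by blast
    moreover have "pi * real j \<le> pi * real k" using j(1) by (intro mult_left_mono) auto
    then have "\<theta> \<le> pi" using k by (simp add: j(2) f_def divide_le_eq)
    moreover have "0 \<le> \<theta>" by (simp add: j(2) f_def)
    ultimately show "\<theta> \<in> T" by (simp add: T_def)
  qed
  moreover have "inj_on f {0..k}"
    using k by (auto simp: f_def inj_on_def)
  ultimately show "finite T" "card T = Suc k" by (auto simp: card_image)
qed

text \<open>A multiset of angles names the class of its torus element; sorting only selects one list
  to build the matrix from. Injectivity is the uniqueness of the angles, surjectivity is the
  existence of the normal form. The exponent may be arbitrary here.\<close>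

lemma bij_betw_torus_classes:
  fixes n m :: nat
  defines "N \<equiv> 2 * n + 1"
  shows "bij_betw (\<lambda>M. {y. osim N y (torus (sorted_list_of_multiset M))})
    (multisets_of_size {\<theta> \<in> {0..pi}. cos (real m * \<theta>) = 1} n)
    {C \<in> conj_classes (SO N). C \<subseteq> {x \<in> carrier (SO N). x [^]\<^bsub>SO N\<^esub> m = \<one>\<^bsub>SO N\<^esub>}}"
    (is "bij_betw ?F (multisets_of_size ?T n) ?S")
proof -
  have N: "N = 1 + 2 * n" "odd N" by (simp_all add: N_def)
  have len: "length (sorted_list_of_multiset M) = n" and sub: "set (sorted_list_of_multiset M) \<subseteq> ?T"
    if "M \<in> multisets_of_size ?T n" for M
    using that by (auto simp: multisets_of_size_def simp flip: size_mset)
  have torus_N: "torus \<theta>s \<in> orth N" if "length \<theta>s = n" for \<theta>s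
    using torus_orth[OF that] N(1) by simp
  have torus_SO: "torus \<theta>s \<in> carrier (SO N)" if "length \<theta>s = n" for \<theta>s
    using torus_N[OF that] by (simp add: SO_carrier_iff torus_det)
  have pow_iff: "torus \<theta>s ^\<^sub>m m = 1\<^sub>m N \<longleftrightarrow> (\<forall>\<theta>\<in>set \<theta>s. cos (real m * \<theta>) = 1)"
    if "length \<theta>s = n" for \<theta>s
    using torus_eq_one_iff[of "map (\<lambda>\<theta>. real m * \<theta>) \<theta>s" n] that by (simp add: torus_pow N)
  show ?thesis
  proof (rule bij_betwI')
    fix M M' assume M: "M \<in> multisets_of_size ?T n" "M' \<in> multisets_of_size ?T n"
    have "M = M'" if "?F M = ?F M'"
    proof -
      have "torus (sorted_list_of_multiset M) \<in> ?F M"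
        using osim_refl[OF orth_carrier[OF torus_N[OF len[OF M(1)]]]] by simp
      then have "osim N (torus (sorted_list_of_multiset M)) (torus (sorted_list_of_multiset M'))"
        unfolding that by simp
      then have "mset (sorted_list_of_multiset M) = mset (sorted_list_of_multiset M')"
        by (rule osim_torus_imp_mset_eq) (use sub[OF M(1)] sub[OF M(2)] in auto)
      then show ?thesis by simp
    qed
    then show "?F M = ?F M' \<longleftrightarrow> M = M'" by blast
  next
    fix M assume M: "M \<in> multisets_of_size ?T n"
    define t where "t = torus (sorted_list_of_multiset M)"
    have t: "t \<in> carrier (SO N)" "t ^\<^sub>m m = 1\<^sub>m N"
      using torus_SO[OF len[OF M]] pow_iff[OF len[OF M]] sub[OF M] by (auto simp: t_def)
    \<comment> \<open>The power equation and membership in the group transfer along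
      \<open>osim\<close>, so the entire class lies in the solution set.\<close>
    have "y \<in> carrier (SO N) \<and> y [^]\<^bsub>SO N\<^esub> m = \<one>\<^bsub>SO N\<^esub>" if y: "osim N y t" for y
    proof -
      have t': "t \<in> orth N" "det t = 1" using t by (simp_all add: SO_carrier_iff)
      have yc: "y \<in> carrier_mat N N"
        using y by (auto simp: osim_def dest: orth_carrier)
      have "y \<in> orth N" using osim_orth[OF t'(1) osim_sym[OF yc y]] .
      then have "y \<in> carrier (SO N)" using osim_det[OF y] t' by (simp add: SO_carrier_iff)
      then show ?thesis
        using osim_pow_one_iff[OF yc y] t by (simp add: SO_pow SO_simps(3))
    qed
    then show "?F M \<in> ?S"
      using t(1) unfolding SO_conj_classes[OF N(2)] t_def[symmetric] by blast
  next
    fix C assume "C \<in> ?S"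
    then obtain x where x: "x \<in> carrier (SO N)" "C = {y. osim N y x}"
      and C: "C \<subseteq> {x \<in> carrier (SO N). x [^]\<^bsub>SO N\<^esub> m = \<one>\<^bsub>SO N\<^esub>}"
      unfolding SO_conj_classes[OF N(2)] by blast
    have x': "x \<in> orth (1 + 2 * n)" "det x = 1" "x \<in> carrier_mat N N"
      using x(1) orth_carrier by (auto simp: SO_carrier_iff N(1))
    obtain \<theta>s where \<theta>s: "length \<theta>s = n" "set \<theta>s \<subseteq> {0..pi}" "osim N x (torus \<theta>s)"
      using osim_torus[OF x'(1,2)] N(1) by metis
    have "x \<in> C" using x(2) osim_refl[OF x'(3)] by simp
    then have "x ^\<^sub>m m = 1\<^sub>m N" using C x(1) by (auto simp: SO_pow SO_simps(3))
    then have "torus \<theta>s ^\<^sub>m m = 1\<^sub>m N" using osim_pow_one_iff[OF x'(3) \<theta>s(3)] by simp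
    then have "mset \<theta>s \<in> multisets_of_size ?T n"
      using \<theta>s pow_iff[OF \<theta>s(1)] by (auto simp: multisets_of_size_def)
    moreover have "osim N (torus \<theta>s) (torus (sorted_list_of_multiset (mset \<theta>s)))"
      using mset_eq_imp_osim_torus[OF _ \<theta>s(1), of "sorted_list_of_multiset (mset \<theta>s)"] N(1) by simp
    then have "osim N x (torus (sorted_list_of_multiset (mset \<theta>s)))"
      using \<theta>s(3) osim_trans by blast
    then have "C = ?F (mset \<theta>s)" unfolding x(2) by (rule osim_class_cong[OF x'(3)])
    ultimately show "\<exists>M\<in>multisets_of_size ?T n. C = ?F M" by blast
  qed
qed

theorem theorem15:
  fixes n m k :: nat
  assumes "n > 0" and "k > 0" and "m = 2 * k"
  shows "num_conj_classes (SO (2 * n + 1)) m = (n + m div 2) choose (m div 2)"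
proof -
  have "num_conj_classes (SO (2 * n + 1)) m =
      card (multisets_of_size {\<theta> \<in> {0..pi}. cos (real m * \<theta>) = 1} n)"
    unfolding num_conj_classes_def using bij_betw_same_card[OF bij_betw_torus_classes] by metis
  \<comment> \<open>Stars and bars: multisets of size \<open>n\<close> over \<open>Suc k\<close>
    angles.\<close>
  also have "\<dots> = (Suc k + n - 1) choose n"
    using card_angles[OF assms(2)] assms(3) by (simp add: card_multisets_of_size)
  also have "\<dots> = (n + k) choose k"
    using binomial_symmetric[of n "n + k"] by (simp add: add.commute)
  finally show ?thesis using assms(3) by simp
qed

end
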